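(* Let $n\ge 2$, let $D_F\subset\mathbb{C}^n$ be an $n$-dimensional strongly pseudoconvex Hartogs domain, let $g_F$ be the associated Kähler metric on $D_F$, and let $X$ be a real holomorphic vector field on $D_F$ such that $(g_F,X)$ is a Kähler–Ricci soliton. Then $g_F$ is Kähler–Einstein. Consequently, $(D_F,g_F)$ is holomorphically isometric to an open subset of the $n$-dimensional complex hyperbolic space $(\mathbb{C}H^n,g_{hyp})$.
   Context: Hartogs domain: let $x_0\in\mathbb{R}^+\cup\{+\infty\}$ (with $\mathbb{R}^+=(0,+\infty)$) and let $F:[0,x_0)\to(0,+\infty)$ be a decreasing continuous function, smooth on $(0,x_0)$. The Hartogs domain associated to $F$ is $$D_F=\{(z_0,z_1,\dots,z_{n-1})\in\mathbb{C}^n : |z_0|^2<x_0,\ |z_1|^2+\cdots+|z_{n-1}|^2<F(|z_0|^2)\}.$$ Put $$\omega_F=\frac{i}{2}\partial\overline{\partial}\log\frac{1}{F(|z_0|^2)-|z_1|^2-\cdots-|z_{n-1}|^2}.$$ "Strongly pseudoconvex Hartogs domain" means that $\omega_F$ is a (smooth, positive definite) Kähler form on $D_F$; in particular $F(|z_0|^2)$ is a smooth function of $z_0$ also at $z_0=0$. The metric $g_F$ is the Kähler metric with Kähler form $\omega_F=\frac{i}{2}\sum_{\alpha,\beta=0}^{n-1}g_{\alpha\bar\beta}\,dz_\alpha\wedge d\bar z_\beta$. Complex hyperbolic space: $(\mathbb{C}H^n,g_{hyp})$ is $(D_F,g_F)$ for $F(x)=1-x$, $0\le x<1$, i.e. the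 unit ball of $\mathbb{C}^n$ with Kähler form $\frac{i}{2}\partial\overline{\partial}\log\frac{1}{1-\sum_{j=0}^{n-1}|z_j|^2}$. Two Kähler manifolds are holomorphically isometric if there is a biholomorphism between them that is an isometry of the Kähler metrics. Ricci curvature: for a Kähler metric $g$ with local components $g_{\alpha\bar\beta}$, $\mathrm{Ric}_{\alpha\bar\beta}=-\frac{\partial^2}{\partial z_\alpha\partial\bar z_\beta}\log\det(g_{\gamma\bar\delta})$. The metric $g$ is Kähler–Einstein if $\mathrm{Ric}_g=\lambda g$ for some constant $\lambda\in\mathbb{R}$. Real holomorphic vector field: a vector field $X$ which in local holomorphic coordinates has the form $X=\sum_{k=0}^{n-1}\left(f_k\frac{\partial}{\partial z_k}+\bar f_k\frac{\partial}{\partial\bar z_k}\right)$ with $f_k$ holomorphic functions. Kähler–Ricci soliton: a pair $(g,X)$ consisting of a Kähler metric $g$ and a real holomorphic vector field $X$ on a complex manifold such that $$\mathrm{Ric}_g=\lambda g+L_Xg$$ for some $\lambda\in\mathbb{R}$, where $L_Xg$ is the Lie derivative, $(L_Xg)(Y,Z)=X(g(Y,Z))-g([X,Y],Z)-g(Y,[X,Z])$. *)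

theory Defs
  imports "HOL-Analysis.Analysis"
begin

text \<open>
  Points of \<open>\<complex>\<^sup>n\<close> have type \<^typ>\<open>complex^'n\<close>, and so have real tangent vectors:
  \<open>v\<close> stands for \<open>\<Sum>\<^sub>k (v\<^sub>k \<partial>/\<partial>z\<^sub>k + cnj v\<^sub>k \<partial>/\<partial>cnj z\<^sub>k)\<close>. All differential operators
  below are meant for functions and fields on an open set \<open>D\<close>.
\<close>

subsection \<open>Smooth and holomorphic functions\<close>

primrec Ck_on :: "nat \<Rightarrow> 'a::real_normed_vector set \<Rightarrow> ('a \<Rightarrow> 'b::real_normed_vector) \<Rightarrow> bool" where
  "Ck_on 0 D f \<longleftrightarrow> continuous_on D f"
| "Ck_on (Suc k) D f \<longleftrightarrow> (\<forall>x\<in>D. f differentiable (at x)) \<and>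
     (\<forall>v. Ck_on k D (\<lambda>x. frechet_derivative f (at x) v))"

definition smooth_on :: "'a::real_normed_vector set \<Rightarrow> ('a \<Rightarrow> 'b::real_normed_vector) \<Rightarrow> bool" where
  "smooth_on D f \<longleftrightarrow> (\<forall>k. Ck_on k D f)"

text \<open>The derivative exists and is complex linear.\<close>

definition holo_fun_on :: "(complex^'n) set \<Rightarrow> (complex^'n \<Rightarrow> complex) \<Rightarrow> bool" where
  "holo_fun_on D f \<longleftrightarrow>
     (\<forall>z\<in>D. \<exists>f'. (f has_derivative f') (at z) \<and> (\<forall>c v. f' (c *s v) = c * f' v))"

definition holo_map_on :: "(complex^'n) set \<Rightarrow> (complex^'n \<Rightarrow> complex^'m) \<Rightarrow> bool" where
  "holo_map_on D f \<longleftrightarrow> (\<forall>k. holo_fun_on D (\<lambda>z. f z $ k))"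

definition biholomorphism ::
  "(complex^'n) set \<Rightarrow> (complex^'m) set \<Rightarrow> (complex^'n \<Rightarrow> complex^'m) \<Rightarrow> bool" where
  "biholomorphism D E \<phi> \<longleftrightarrow> open D \<and> open E \<and> bij_betw \<phi> D E \<and>
     holo_map_on D \<phi> \<and> holo_map_on E (inv_into D \<phi>)"

definition d_z :: "'n \<Rightarrow> (complex^'n \<Rightarrow> complex) \<Rightarrow> complex^'n \<Rightarrow> complex" where
  "d_z k f z = (frechet_derivative f (at z) (axis k 1)
     - \<i> * frechet_derivative f (at z) (axis k \<i>)) / 2"

definition d_zbar :: "'n \<Rightarrow> (complex^'n \<Rightarrow> complex) \<Rightarrow> complex^'n \<Rightarrow> complex" where
  "d_zbar k f z = (frechet_derivative f (at z) (axis k 1)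
     + \<i> * frechet_derivative f (at z) (axis k \<i>)) / 2"

subsection \<open>Kaehler metrics in the global coordinates\<close>

text \<open>
  A symmetric tensor of type \<open>(1,1)\<close> is given by the matrix of its components \<open>h\<^sub>\<alpha>\<^sub>\<beta>\<close>
  (\<open>\<beta>\<close> barred) with respect to \<open>dz\<^sub>\<alpha> \<otimes> cnj dz\<^sub>\<beta>\<close>. The normalisation of the real tensor is
  the one for which \<open>\<omega> = (i/2) \<Sum> h\<^sub>\<alpha>\<^sub>\<beta> dz\<^sub>\<alpha> \<and> cnj dz\<^sub>\<beta>\<close> satisfies \<open>\<omega>(v,w) = h(iv,w)\<close>; for the
  identity matrix it is the Euclidean metric.
\<close>

definition tensor :: "complex^'n^'n \<Rightarrow> complex^'n \<Rightarrow> complex^'n \<Rightarrow> real" where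
  "tensor h v w = Re (\<Sum>\<alpha>\<in>UNIV. \<Sum>\<beta>\<in>UNIV. h $ \<alpha> $ \<beta> * v $ \<alpha> * cnj (w $ \<beta>))"

text \<open>The last condition says that the associated form \<open>\<omega>\<close> is closed.\<close>

definition kaehler_metric_on :: "(complex^'n) set \<Rightarrow> (complex^'n \<Rightarrow> complex^'n^'n) \<Rightarrow> bool" where
  "kaehler_metric_on D g \<longleftrightarrow> open D \<and> smooth_on D g \<and>
     (\<forall>z\<in>D. \<forall>\<alpha> \<beta>. g z $ \<beta> $ \<alpha> = cnj (g z $ \<alpha> $ \<beta>)) \<and>
     (\<forall>z\<in>D. \<forall>v. v \<noteq> 0 \<longrightarrow> tensor (g z) v v > 0) \<and>
     (\<forall>z\<in>D. \<forall>\<alpha> \<beta> \<gamma>. d_z \<gamma> (\<lambda>w. g w $ \<alpha> $ \<beta>) z = d_z \<alpha> (\<lambda>w. g w $ \<gamma> $ \<beta>) z)"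

text \<open>The determinant is a positive real, on which the principal branch is the real logarithm.\<close>

definition ricci :: "(complex^'n \<Rightarrow> complex^'n^'n) \<Rightarrow> complex^'n \<Rightarrow> complex^'n^'n" where
  "ricci g z = (\<chi> \<alpha> \<beta>. - d_z \<alpha> (d_zbar \<beta> (\<lambda>w. ln (det (g w)))) z)"

definition kaehler_einstein_on :: "(complex^'n) set \<Rightarrow> (complex^'n \<Rightarrow> complex^'n^'n) \<Rightarrow> bool" where
  "kaehler_einstein_on D g \<longleftrightarrow> kaehler_metric_on D g \<and>
     (\<exists>\<Lambda>::real. \<forall>z\<in>D. ricci g z = \<Lambda> *\<^sub>R g z)"

text \<open>
  With the above identification, the real field \<open>\<Sum>\<^sub>k (f\<^sub>k \<partial>/\<partial>z\<^sub>k + cnj f\<^sub>k \<partial>/\<partial>cnj z\<^sub>k)\<close> is the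
  map \<open>z \<mapsto> (f\<^sub>k z)\<^sub>k\<close>.
\<close>

definition real_holo_field_on :: "(complex^'n) set \<Rightarrow> (complex^'n \<Rightarrow> complex^'n) \<Rightarrow> bool" where
  "real_holo_field_on D X \<longleftrightarrow> holo_map_on D X"

definition lie_bracket ::
  "(complex^'n \<Rightarrow> complex^'n) \<Rightarrow> (complex^'n \<Rightarrow> complex^'n) \<Rightarrow> complex^'n \<Rightarrow> complex^'n" where
  "lie_bracket X Y z =
     frechet_derivative Y (at z) (X z) - frechet_derivative X (at z) (Y z)"

definition lie_derivative ::
  "(complex^'n \<Rightarrow> complex^'n) \<Rightarrow> (complex^'n \<Rightarrow> complex^'n^'n) \<Rightarrow>
   (complex^'n \<Rightarrow> complex^'n) \<Rightarrow> (complex^'n \<Rightarrow> complex^'n) \<Rightarrow> complex^'n \<Rightarrow> real" where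
  "lie_derivative X g Y Z z =
     frechet_derivative (\<lambda>w. tensor (g w) (Y w) (Z w)) (at z) (X z)
     - tensor (g z) (lie_bracket X Y z) (Z z)
     - tensor (g z) (Y z) (lie_bracket X Z z)"

definition kaehler_ricci_soliton_on ::
  "(complex^'n) set \<Rightarrow> (complex^'n \<Rightarrow> complex^'n^'n) \<Rightarrow> (complex^'n \<Rightarrow> complex^'n) \<Rightarrow> bool" where
  "kaehler_ricci_soliton_on D g X \<longleftrightarrow> kaehler_metric_on D g \<and> real_holo_field_on D X \<and>
     (\<exists>\<Lambda>::real. \<forall>Y Z. smooth_on D Y \<and> smooth_on D Z \<longrightarrow>
        (\<forall>z\<in>D. tensor (ricci g z) (Y z) (Z z) =
           \<Lambda> * tensor (g z) (Y z) (Z z) + lie_derivative X g Y Z z))"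

definition holo_isometric ::
  "(complex^'n) set \<Rightarrow> (complex^'n \<Rightarrow> complex^'n^'n) \<Rightarrow>
   (complex^'m) set \<Rightarrow> (complex^'m \<Rightarrow> complex^'m^'m) \<Rightarrow> bool" where
  "holo_isometric D g E h \<longleftrightarrow> (\<exists>\<phi>. biholomorphism D E \<phi> \<and>
     (\<forall>z\<in>D. \<forall>v w. tensor (h (\<phi> z)) (frechet_derivative \<phi> (at z) v) (frechet_derivative \<phi> (at z) w)
        = tensor (g z) v w))"

subsection \<open>Hartogs domains\<close>

text \<open>
  The index \<open>i\<^sub>0\<close> marks the distinguished coordinate \<open>z\<^sub>0\<close>; the remaining indices are those of
  \<open>z\<^sub>1, \<dots>, z\<^sub>n\<^sub>-\<^sub>1\<close>. Only the values of \<open>F\<close> on \<open>[0, x\<^sub>0)\<close> matter.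
\<close>

definition hartogs_function :: "ereal \<Rightarrow> (real \<Rightarrow> real) \<Rightarrow> bool" where
  "hartogs_function x\<^sub>0 F \<longleftrightarrow> 0 < x\<^sub>0 \<and>
     (\<forall>x. 0 \<le> x \<and> ereal x < x\<^sub>0 \<longrightarrow> 0 < F x) \<and>
     antimono_on {x. 0 \<le> x \<and> ereal x < x\<^sub>0} F \<and>
     continuous_on {x. 0 \<le> x \<and> ereal x < x\<^sub>0} F \<and>
     smooth_on {x. 0 < x \<and> ereal x < x\<^sub>0} F"

definition hartogs_domain :: "'n::finite \<Rightarrow> ereal \<Rightarrow> (real \<Rightarrow> real) \<Rightarrow> (complex^'n) set" where
  "hartogs_domain i\<^sub>0 x\<^sub>0 F = {z. ereal ((cmod (z $ i\<^sub>0))\<^sup>2) < x\<^sub>0 \<and>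
     (\<Sum>k\<in>UNIV - {i\<^sub>0}. (cmod (z $ k))\<^sup>2) < F ((cmod (z $ i\<^sub>0))\<^sup>2)}"

definition hartogs_potential :: "'n::finite \<Rightarrow> (real \<Rightarrow> real) \<Rightarrow> complex^'n \<Rightarrow> real" where
  "hartogs_potential i\<^sub>0 F z =
     ln (1 / (F ((cmod (z $ i\<^sub>0))\<^sup>2) - (\<Sum>k\<in>UNIV - {i\<^sub>0}. (cmod (z $ k))\<^sup>2)))"

definition hartogs_metric :: "'n::finite \<Rightarrow> (real \<Rightarrow> real) \<Rightarrow> complex^'n \<Rightarrow> complex^'n^'n" where
  "hartogs_metric i\<^sub>0 F z =
     (\<chi> \<alpha> \<beta>. d_z \<alpha> (d_zbar \<beta> (\<lambda>w. complex_of_real (hartogs_potential i\<^sub>0 F w))) z)"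

text \<open>
  Smoothness of \<open>F(|z\<^sub>0|\<^sup>2)\<close>, also at \<open>z\<^sub>0 = 0\<close>, is stated explicitly: \<^const>\<open>frechet_derivative\<close>
  is unspecified where the potential is not differentiable, so it does not follow from
  smoothness of the \<^const>\<open>hartogs_metric\<close> alone.
\<close>

definition strongly_pseudoconvex_hartogs :: "'n::finite \<Rightarrow> ereal \<Rightarrow> (real \<Rightarrow> real) \<Rightarrow> bool" where
  "strongly_pseudoconvex_hartogs i\<^sub>0 x\<^sub>0 F \<longleftrightarrow> hartogs_function x\<^sub>0 F \<and>
     smooth_on {\<zeta>::complex. ereal ((cmod \<zeta>)\<^sup>2) < x\<^sub>0} (\<lambda>\<zeta>. F ((cmod \<zeta>)\<^sup>2)) \<and>
     kaehler_metric_on (hartogs_domain i\<^sub>0 x\<^sub>0 F) (hartogs_metric i\<^sub>0 F)"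

text \<open>Complex hyperbolic space: the unit ball as the Hartogs domain of \<open>F(x) = 1 - x\<close> on \<open>[0,1)\<close>.\<close>

definition complex_hyperbolic_space :: "'n::finite \<Rightarrow> (complex^'n) set" where
  "complex_hyperbolic_space i\<^sub>0 = hartogs_domain i\<^sub>0 1 (\<lambda>x. 1 - x)"

definition hyperbolic_metric :: "'n::finite \<Rightarrow> complex^'n \<Rightarrow> complex^'n^'n" where
  "hyperbolic_metric i\<^sub>0 = hartogs_metric i\<^sub>0 (\<lambda>x. 1 - x)"

end

theory Submission
  imports Defs "HOL-Complex_Analysis.Cauchy_Integral_Formula"
begin

text \<open>
  Write \<open>n\<close> for the dimension, \<open>x = |z\<^sub>0|\<^sup>2\<close> and \<open>z'\<close> for the remaining coordinates, and put
  \<open>N = F(x) - |z'|\<^sup>2\<close>, so that the potential is \<open>- log N\<close>. The matrix \<open>g\<close> of the metric is a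
  diagonal matrix plus one of rank one, and \<open>det g = \<psi>(x) / N\<^sup>n\<^sup>+\<^sup>1\<close> with
  \<open>\<psi> = x F'\<^sup>2 - F (F' + x F'') = - F\<^sup>2 (x F'/F)'\<close>. Hence
  \<open>Ric = - (n+1) g - \<partial>\<partial>bar log \<psi>(|z\<^sub>0|\<^sup>2)\<close>, where the second term has a single component, the
  one in the direction \<open>z\<^sub>0\<close>.

  Everything except the field \<open>X\<close> is invariant under rotations of the coordinates, so the
  soliton equation may be averaged over circles. By the mean value property of holomorphic
  functions only the linear rotation-invariant part of \<open>X\<close> survives, say \<open>A\<close> times the radial
  field in \<open>z\<^sub>0\<close> and \<open>B\<close> times the radial field in one further coordinate \<open>z\<^sub>j\<close>; here the
  existence of a second coordinate is used. Along the disc in direction \<open>z\<^sub>j\<close> the equation for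
  the component \<open>jj\<close> is affine in \<open>|z\<^sub>j|\<^sup>2\<close> after averaging. Its two coefficients give
  \<open>\<Lambda> = - (n+1)\<close> and \<open>B = A W(x)\<close> for \<open>W = x F'/F\<close>. But \<open>W' = - \<psi>/F\<^sup>2 < 0\<close>, so \<open>W\<close> is not
  constant and \<open>A = 0\<close>. The component \<open>00\<close> along \<open>z' = 0\<close> then says that \<open>log \<psi>(|z\<^sub>0|\<^sup>2)\<close> is
  harmonic (\<open>log_psi_laplacian_zero\<close>).

  A radial harmonic function which stays bounded at the origin is constant, so \<open>\<psi>\<close> is a
  constant \<open>c\<close>. This is a second order equation for \<open>F\<close> with the first integral
  \<open>W\<^sup>2 - W - c x/F\<^sup>2\<close>, which is \<open>0\<close> because \<open>F(|z\<^sub>0|\<^sup>2)\<close> is continuously differentiable at the origin.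
  Together the two equations force \<open>F'' = 0\<close>, that is \<open>F(x) = a - b x\<close> with \<open>a, b > 0\<close>
  (\<open>hartogs_function_affine\<close>). For such \<open>F\<close> the function \<open>\<psi> = a b\<close> is constant, so the metric
  is Einstein, and rescaling the coordinates turns \<open>N\<close> into \<open>N / a = 1 - |z|\<^sup>2\<close>, which changes
  the potential only by a constant.
\<close>

section \<open>Wirtinger derivatives\<close>

lemma frechet_derivative_cong_open:
  assumes "open T" "z \<in> T" "\<And>w. w \<in> T \<Longrightarrow> f w = g w"
  shows "frechet_derivative f (at z) = frechet_derivative g (at z)"
proof -
  have "(f has_derivative D) (at z) = (g has_derivative D) (at z)" for D
    using has_derivative_transform_within_open[of f D z UNIV T g]
      has_derivative_transform_within_open[of g D z UNIV T f] assms by auto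
  then show ?thesis
    by (simp add: frechet_derivative_def)
qed

lemma d_z_cong_open:
  assumes "open T" "z \<in> T" "\<And>w. w \<in> T \<Longrightarrow> f w = g w"
  shows "d_z k f z = d_z k g z"
  using frechet_derivative_cong_open[OF assms] by (simp add: d_z_def)

lemma d_zbar_cong_open:
  assumes "open T" "z \<in> T" "\<And>w. w \<in> T \<Longrightarrow> f w = g w"
  shows "d_zbar k f z = d_zbar k g z"
  using frechet_derivative_cong_open[OF assms] by (simp add: d_zbar_def)

lemma d_z_has_derivative:
  assumes "(f has_derivative f') (at z)"
  shows "d_z k f z = (f' (axis k 1) - \<i> * f' (axis k \<i>)) / 2"
  using frechet_derivative_at[OF assms] by (simp add: d_z_def)

lemma d_zbar_has_derivative:
  assumes "(f has_derivative f') (at z)"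
  shows "d_zbar k f z = (f' (axis k 1) + \<i> * f' (axis k \<i>)) / 2"
  using frechet_derivative_at[OF assms] by (simp add: d_zbar_def)

text \<open>
  The general real-valued real-linear form on \<open>\<complex>\<^sup>n\<close>, parametrised so that a real function
  with differential \<open>re_grad b\<close> has the antiholomorphic derivatives \<open>b k\<close>.
\<close>

definition re_grad :: "('n::finite \<Rightarrow> complex) \<Rightarrow> complex^'n \<Rightarrow> real" where
  "re_grad b v = 2 * Re (\<Sum>k\<in>UNIV. cnj (b k) * v $ k)"

lemma re_grad_axis [simp]: "re_grad b (axis k c) = 2 * Re (cnj (b k) * c)"
proof -
  have "(\<Sum>j\<in>UNIV. cnj (b j) * axis k c $ j) = (\<Sum>j\<in>UNIV. if j = k then cnj (b k) * c else 0)"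
    by (intro sum.cong) (auto simp: axis_def)
  then show ?thesis by (simp add: re_grad_def)
qed

lemma d_zbar_of_real:
  assumes "(f has_derivative re_grad b) (at z)"
  shows "d_zbar k (\<lambda>w. complex_of_real (f w)) z = b k"
proof -
  have "((\<lambda>w. complex_of_real (f w)) has_derivative (\<lambda>v. complex_of_real (re_grad b v))) (at z)"
    using assms by (rule has_derivative_of_real)
  from d_zbar_has_derivative[OF this] show ?thesis
    by (simp add: complex_eq_iff)
qed

lemma has_derivative_cmod_square_nth:
  fixes z :: "complex^'n::finite"
  shows "((\<lambda>w. (cmod (w $ k))\<^sup>2) has_derivative re_grad (\<lambda>j. if j = k then z $ k else 0)) (at z)"
proof -
  have nth: "((\<lambda>w. w $ k) has_derivative (\<lambda>v. v $ k)) (at z)"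
    by (rule bounded_linear.has_derivative[OF bounded_linear_vec_nth has_derivative_ident])
  have "((\<lambda>w. w $ k \<bullet> w $ k) has_derivative (\<lambda>v. z $ k \<bullet> v $ k + v $ k \<bullet> z $ k)) (at z)"
    by (rule has_derivative_inner[OF nth nth])
  moreover have "(\<lambda>v. z $ k \<bullet> v $ k + v $ k \<bullet> z $ k) = re_grad (\<lambda>j. if j = k then z $ k else 0)"
  proof
    fix v :: "complex^'n"
    have "(\<Sum>j\<in>UNIV. cnj (if j = k then z $ k else 0) * v $ j)
        = (\<Sum>j\<in>UNIV. if j = k then cnj (z $ k) * v $ k else 0)"
      by (intro sum.cong) auto
    then show "z $ k \<bullet> v $ k + v $ k \<bullet> z $ k = re_grad (\<lambda>j. if j = k then z $ k else 0) v"
      by (simp add: re_grad_def inner_complex_def)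
  qed
  ultimately show ?thesis by (simp add: dot_square_norm)
qed

lemma re_grad_scale: "re_grad (\<lambda>j. of_real c * b j) v = c * re_grad b v"
  by (simp add: re_grad_def sum_distrib_left mult.assoc mult.left_commute)

lemma re_grad_add: "re_grad (\<lambda>j. b j + c j) v = re_grad b v + re_grad c v"
  by (simp add: re_grad_def sum.distrib algebra_simps)

lemma re_grad_sum: "re_grad (\<lambda>j. \<Sum>k\<in>K. b k j) v = (\<Sum>k\<in>K. re_grad (b k) v)"
  by (induction K rule: infinite_finite_induct) (simp_all add: re_grad_add, simp_all add: re_grad_def)

lemma has_derivative_radial:
  assumes "(u has_real_derivative u') (at ((cmod (z $ k))\<^sup>2))"
  shows "((\<lambda>w. u ((cmod (w $ k))\<^sup>2)) has_derivative
           re_grad (\<lambda>j. if j = k then of_real u' * z $ k else 0)) (at z)"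
proof -
  have "((\<lambda>w. u ((cmod (w $ k))\<^sup>2)) has_derivative
      (\<lambda>v. u' * re_grad (\<lambda>j. if j = k then z $ k else 0) v)) (at z)"
    using has_derivative_compose[OF has_derivative_cmod_square_nth[of k z]
        assms[unfolded has_field_derivative_def]] .
  moreover have "(\<lambda>v. u' * re_grad (\<lambda>j. if j = k then z $ k else 0) v)
      = re_grad (\<lambda>j. if j = k then of_real u' * z $ k else 0)"
    by (simp add: re_grad_scale[symmetric] fun_eq_iff if_distrib cong: if_cong)
  ultimately show ?thesis by simp
qed

section \<open>The complex Hessian of the potential\<close>

definition hartogs_gap :: "'n::finite \<Rightarrow> (real \<Rightarrow> real) \<Rightarrow> complex^'n \<Rightarrow> real" where
  "hartogs_gap i\<^sub>0 F z = F ((cmod (z $ i\<^sub>0))\<^sup>2) - (\<Sum>k\<in>UNIV - {i\<^sub>0}. (cmod (z $ k))\<^sup>2)"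

text \<open>
  The derivatives of \<open>hartogs_gap\<close> with respect to \<open>cnj z\<^sub>\<beta>\<close>, where \<open>F1\<close> is the derivative
  of \<open>F\<close>.
\<close>

definition gap_dbar :: "'n::finite \<Rightarrow> (real \<Rightarrow> real) \<Rightarrow> complex^'n \<Rightarrow> 'n \<Rightarrow> complex" where
  "gap_dbar i\<^sub>0 F1 z \<beta> = (if \<beta> = i\<^sub>0 then of_real (F1 ((cmod (z $ i\<^sub>0))\<^sup>2)) * z $ i\<^sub>0 else - z $ \<beta>)"

lemma has_derivative_hartogs_gap:
  assumes "(F has_real_derivative F1 ((cmod (z $ i\<^sub>0))\<^sup>2)) (at ((cmod (z $ i\<^sub>0))\<^sup>2))"
  shows "(hartogs_gap i\<^sub>0 F has_derivative re_grad (gap_dbar i\<^sub>0 F1 z)) (at z)"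
proof -
  let ?x = "(cmod (z $ i\<^sub>0))\<^sup>2"
  have "((\<lambda>w. F ((cmod (w $ i\<^sub>0))\<^sup>2) - (\<Sum>k\<in>UNIV - {i\<^sub>0}. (cmod (w $ k))\<^sup>2)) has_derivative
     (\<lambda>v. re_grad (\<lambda>j. if j = i\<^sub>0 then of_real (F1 ?x) * z $ i\<^sub>0 else 0) v
        - (\<Sum>k\<in>UNIV - {i\<^sub>0}. re_grad (\<lambda>j. if j = k then z $ k else 0) v))) (at z)"
    by (intro has_derivative_diff has_derivative_sum has_derivative_cmod_square_nth
        has_derivative_radial assms)
  moreover have "(\<lambda>v. re_grad (\<lambda>j. if j = i\<^sub>0 then of_real (F1 ?x) * z $ i\<^sub>0 else 0) v
        - (\<Sum>k\<in>UNIV - {i\<^sub>0}. re_grad (\<lambda>j. if j = k then z $ k else 0) v))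
        = re_grad (gap_dbar i\<^sub>0 F1 z)"
  proof
    fix v
    have "re_grad (\<lambda>j. if j = i\<^sub>0 then of_real (F1 ?x) * z $ i\<^sub>0 else 0) v
        - (\<Sum>k\<in>UNIV - {i\<^sub>0}. re_grad (\<lambda>j. if j = k then z $ k else 0) v)
        = re_grad (\<lambda>j. (if j = i\<^sub>0 then of_real (F1 ?x) * z $ i\<^sub>0 else 0)
            + of_real (-1) * (\<Sum>k\<in>UNIV - {i\<^sub>0}. if j = k then z $ k else 0)) v"
      by (simp only: re_grad_sum re_grad_scale re_grad_add)
    also have "(\<lambda>j. (if j = i\<^sub>0 then of_real (F1 ?x) * z $ i\<^sub>0 else 0)
            + of_real (-1) * (\<Sum>k\<in>UNIV - {i\<^sub>0}. if j = k then z $ k else 0)) = gap_dbar i\<^sub>0 F1 z"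
      by (auto simp: gap_dbar_def fun_eq_iff)
    finally show "re_grad (\<lambda>j. if j = i\<^sub>0 then of_real (F1 ?x) * z $ i\<^sub>0 else 0) v
        - (\<Sum>k\<in>UNIV - {i\<^sub>0}. re_grad (\<lambda>j. if j = k then z $ k else 0) v)
        = re_grad (gap_dbar i\<^sub>0 F1 z) v" .
  qed
  ultimately show ?thesis by (simp add: hartogs_gap_def[abs_def])
qed

text \<open>
  Since \<open>N\<close> is real, its holomorphic derivatives are the conjugates of the coefficients \<open>b\<close>.
\<close>

lemma d_z_divide_of_real:
  assumes f: "(f has_derivative f') (at z)" and N: "(N has_derivative re_grad b) (at z)"
    and "N z \<noteq> 0"
  shows "d_z k (\<lambda>w. f w / of_real (N w)) z
    = (d_z k f z * of_real (N z) - f z * cnj (b k)) / (of_real (N z))\<^sup>2"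
proof -
  have N': "((\<lambda>w. complex_of_real (N w)) has_derivative (\<lambda>v. of_real (re_grad b v))) (at z)"
    using N by (rule has_derivative_of_real)
  have "((\<lambda>w. f w / of_real (N w)) has_derivative (\<lambda>v. (f' v * of_real (N z)
      - f z * of_real (re_grad b v)) / (of_real (N z) * of_real (N z)))) (at z)"
    by (rule has_derivative_divide'[OF f N']) (use assms in simp)
  then have "d_z k (\<lambda>w. f w / of_real (N w)) z
      = ((f' (axis k 1) - \<i> * f' (axis k \<i>)) / 2 * of_real (N z)
        - f z * ((of_real (re_grad b (axis k 1)) - \<i> * of_real (re_grad b (axis k \<i>))) / 2))
        / (of_real (N z))\<^sup>2"
    using assms(3) by (simp add: d_z_has_derivative power2_eq_square divide_simps)
      (simp add: algebra_simps)
  also have "(of_real (re_grad b (axis k 1)) - \<i> * of_real (re_grad b (axis k \<i>))) / 2 = cnj (b k)"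
    by (simp add: complex_eq_iff)
  finally show ?thesis by (simp add: d_z_has_derivative[OF f])
qed

lemma has_derivative_radial_times_nth:
  fixes z :: "complex^'n::finite"
  assumes "(u has_real_derivative u') (at ((cmod (z $ k))\<^sup>2))"
  shows "((\<lambda>w. of_real (u ((cmod (w $ k))\<^sup>2)) * w $ k) has_derivative
     (\<lambda>v. of_real (u ((cmod (z $ k))\<^sup>2)) * v $ k
        + of_real (re_grad (\<lambda>j. if j = k then of_real u' * z $ k else 0) v) * z $ k)) (at z)"
  by (rule has_derivative_mult[OF has_derivative_of_real[OF has_derivative_radial[OF assms]]
        bounded_linear.has_derivative[OF bounded_linear_vec_nth has_derivative_ident]])

lemma d_z_radial_times_nth:
  assumes "(u has_real_derivative u') (at ((cmod (z $ k))\<^sup>2))"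
  shows "d_z \<alpha> (\<lambda>w. of_real (u ((cmod (w $ k))\<^sup>2)) * w $ k) z
    = (if \<alpha> = k then of_real (u ((cmod (z $ k))\<^sup>2) + (cmod (z $ k))\<^sup>2 * u') else 0)"
proof (cases "\<alpha> = k")
  case True
  have "cnj (z $ k) * z $ k = of_real ((cmod (z $ k))\<^sup>2)"
    by (metis complex_norm_square mult.commute)
  then show ?thesis using True unfolding d_z_has_derivative[OF has_derivative_radial_times_nth[OF assms]]
    by (simp add: complex_eq_iff cmod_power2) (simp add: power2_eq_square algebra_simps)
next
  case False
  then have "axis \<alpha> c $ k = 0" for c :: complex
    by (simp add: axis_def)
  then show ?thesis using False unfolding d_z_has_derivative[OF has_derivative_radial_times_nth[OF assms]]
    by simp
qed

text \<open>
  The quotient rule for \<open>\<partial>\<^sub>\<alpha>\<partial>\<^sub>\<beta>bar (- log N) = (\<partial>\<^sub>\<alpha>N \<cdot> \<partial>\<^sub>\<beta>bar N - N \<cdot> \<partial>\<^sub>\<alpha>\<partial>\<^sub>\<beta>bar N) / N\<^sup>2\<close>. The mixed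
  derivatives of \<open>N\<close> form a diagonal matrix because \<open>N\<close> is a sum of radial functions of the
  single coordinates.
\<close>

definition hess_log_gap ::
  "'n::finite \<Rightarrow> (real \<Rightarrow> real) \<Rightarrow> (real \<Rightarrow> real) \<Rightarrow> (real \<Rightarrow> real) \<Rightarrow> complex^'n \<Rightarrow> 'n \<Rightarrow> 'n \<Rightarrow> complex" where
  "hess_log_gap i\<^sub>0 F F1 F2 z \<alpha> \<beta> =
     (cnj (gap_dbar i\<^sub>0 F1 z \<alpha>) * gap_dbar i\<^sub>0 F1 z \<beta>
       - of_real (hartogs_gap i\<^sub>0 F z) * (if \<alpha> = \<beta> then
           (if \<alpha> = i\<^sub>0 then of_real (F1 ((cmod (z $ i\<^sub>0))\<^sup>2) + (cmod (z $ i\<^sub>0))\<^sup>2 * F2 ((cmod (z $ i\<^sub>0))\<^sup>2))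
            else -1) else 0)) / (of_real (hartogs_gap i\<^sub>0 F z))\<^sup>2"

lemma open_hartogs_gap_pos:
  assumes S: "open S" and F: "\<And>x. x \<in> S \<Longrightarrow> (F has_real_derivative F1 x) (at x)"
  shows "open {w::complex^'n::finite. (cmod (w $ i\<^sub>0))\<^sup>2 \<in> S \<and> hartogs_gap i\<^sub>0 F w > 0}"
proof -
  let ?T = "(\<lambda>w::complex^'n. (cmod (w $ i\<^sub>0))\<^sup>2) -` S"
  have T: "open ?T"
    by (rule open_vimage[OF S]) (intro continuous_intros)
  have "continuous_on ?T (hartogs_gap i\<^sub>0 F)"
    using has_derivative_continuous[OF has_derivative_hartogs_gap[where ?F1.0=F1, OF F]]
    by (intro continuous_at_imp_continuous_on) blast
  then have "open (?T \<inter> hartogs_gap i\<^sub>0 F -` {0<..})"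
    by (rule continuous_open_preimage[OF _ T]) simp
  also have "?T \<inter> hartogs_gap i\<^sub>0 F -` {0<..} = {w. (cmod (w $ i\<^sub>0))\<^sup>2 \<in> S \<and> hartogs_gap i\<^sub>0 F w > 0}"
    by auto
  finally show ?thesis .
qed

text \<open>
  Both the potential of the metric and the logarithm of its determinant are a radial
  function of \<open>z\<^sub>0\<close> minus a multiple of \<open>log N\<close>, so this one computation yields the metric
  and the Ricci tensor. The set \<open>S\<close> is where \<open>F\<close> is known to be differentiable: the interval
  \<open>(0, x\<^sub>0)\<close> for a general Hartogs function, the whole line for an affine one.
\<close>

lemma ddbar_radial_minus_log_gap:
  fixes z :: "complex^'n::finite"
  assumes S: "open S" and zS: "(cmod (z $ i\<^sub>0))\<^sup>2 \<in> S" and gap: "hartogs_gap i\<^sub>0 F z > 0"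
    and F: "\<And>x. x \<in> S \<Longrightarrow> (F has_real_derivative F1 x) (at x)"
    and F1: "\<And>x. x \<in> S \<Longrightarrow> (F1 has_real_derivative F2 x) (at x)"
    and A: "\<And>x. x \<in> S \<Longrightarrow> (A has_real_derivative A1 x) (at x)"
    and A1: "\<And>x. x \<in> S \<Longrightarrow> (A1 has_real_derivative A2 x) (at x)"
  shows "d_z \<alpha> (d_zbar \<beta> (\<lambda>w. of_real (A ((cmod (w $ i\<^sub>0))\<^sup>2) - c * ln (hartogs_gap i\<^sub>0 F w)))) z
    = (if \<alpha> = i\<^sub>0 \<and> \<beta> = i\<^sub>0
        then of_real (A1 ((cmod (z $ i\<^sub>0))\<^sup>2) + (cmod (z $ i\<^sub>0))\<^sup>2 * A2 ((cmod (z $ i\<^sub>0))\<^sup>2)) else 0)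
      + of_real c * hess_log_gap i\<^sub>0 F F1 F2 z \<alpha> \<beta>"
proof -
  let ?T = "{w::complex^'n. (cmod (w $ i\<^sub>0))\<^sup>2 \<in> S \<and> hartogs_gap i\<^sub>0 F w > 0}"
  define R where "R w = (if \<beta> = i\<^sub>0 then of_real (A1 ((cmod (w $ i\<^sub>0))\<^sup>2)) * w $ i\<^sub>0 else 0)" for w :: "complex^'n"
  define G where "G w = gap_dbar i\<^sub>0 F1 w \<beta>" for w :: "complex^'n"
  have T: "open ?T" by (rule open_hartogs_gap_pos[OF S F])
  have first: "d_zbar \<beta> (\<lambda>w. of_real (A ((cmod (w $ i\<^sub>0))\<^sup>2) - c * ln (hartogs_gap i\<^sub>0 F w))) w
      = R w - of_real c * (G w / of_real (hartogs_gap i\<^sub>0 F w))" if w: "w \<in> ?T" for w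
  proof -
    let ?N = "hartogs_gap i\<^sub>0 F w"
    let ?a = "\<lambda>j. if j = i\<^sub>0 then of_real (A1 ((cmod (w $ i\<^sub>0))\<^sup>2)) * w $ i\<^sub>0 else 0"
    have "((\<lambda>w. A ((cmod (w $ i\<^sub>0))\<^sup>2) - c * ln (hartogs_gap i\<^sub>0 F w)) has_derivative
        (\<lambda>v. re_grad ?a v - c * (1 / ?N * re_grad (gap_dbar i\<^sub>0 F1 w) v))) (at w)"
      using w by (auto intro!: derivative_eq_intros has_derivative_radial A F
          has_derivative_hartogs_gap simp: divide_inverse mult_ac)
    also have "(\<lambda>v. re_grad ?a v - c * (1 / ?N * re_grad (gap_dbar i\<^sub>0 F1 w) v))
        = re_grad (\<lambda>j. ?a j + of_real (- c / ?N) * gap_dbar i\<^sub>0 F1 w j)"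
      by (simp only: fun_eq_iff re_grad_add re_grad_scale) simp
    finally have "d_zbar \<beta> (\<lambda>w. of_real (A ((cmod (w $ i\<^sub>0))\<^sup>2) - c * ln (hartogs_gap i\<^sub>0 F w))) w
        = ?a \<beta> + of_real (- c / ?N) * gap_dbar i\<^sub>0 F1 w \<beta>"
      by (rule d_zbar_of_real)
    then show ?thesis by (simp add: R_def G_def)
  qed
  have "\<exists>R'. (R has_derivative R') (at z)"
    unfolding R_def using has_derivative_radial_times_nth[OF A1[OF zS]]
    by (cases "\<beta> = i\<^sub>0") (auto intro: has_derivative_const)
  then obtain R' where R': "(R has_derivative R') (at z)" ..
  have nth: "((\<lambda>w. w $ \<beta>) has_derivative (\<lambda>v. v $ \<beta>)) (at z)"
    by (rule bounded_linear.has_derivative[OF bounded_linear_vec_nth has_derivative_ident])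
  obtain G' where G': "(G has_derivative G') (at z)"
    unfolding G_def gap_dbar_def
    using has_derivative_radial_times_nth[OF F1[OF zS]] has_derivative_minus[OF nth]
    by (cases "\<beta> = i\<^sub>0") auto
  have N': "(hartogs_gap i\<^sub>0 F has_derivative re_grad (gap_dbar i\<^sub>0 F1 z)) (at z)"
    by (rule has_derivative_hartogs_gap[where ?F1.0=F1, OF F[OF zS]])
  have dR: "d_z \<alpha> R z = (if \<alpha> = i\<^sub>0 \<and> \<beta> = i\<^sub>0
        then of_real (A1 ((cmod (z $ i\<^sub>0))\<^sup>2) + (cmod (z $ i\<^sub>0))\<^sup>2 * A2 ((cmod (z $ i\<^sub>0))\<^sup>2)) else 0)"
    unfolding R_def using d_z_radial_times_nth[OF A1[OF zS], of \<alpha>] d_z_has_derivative[OF has_derivative_const, of \<alpha> 0 z]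
    by (cases "\<beta> = i\<^sub>0") auto
  have dG: "d_z \<alpha> G z = (if \<alpha> = \<beta> then
           (if \<alpha> = i\<^sub>0 then of_real (F1 ((cmod (z $ i\<^sub>0))\<^sup>2) + (cmod (z $ i\<^sub>0))\<^sup>2 * F2 ((cmod (z $ i\<^sub>0))\<^sup>2))
            else -1) else 0)"
    unfolding G_def gap_dbar_def
    using d_z_radial_times_nth[OF F1[OF zS], of \<alpha>] d_z_has_derivative[OF has_derivative_minus[OF nth], of \<alpha>]
    by (cases "\<beta> = i\<^sub>0") (auto simp: axis_def)
  have Q': "\<exists>Q'. ((\<lambda>w. G w / of_real (hartogs_gap i\<^sub>0 F w)) has_derivative Q') (at z)"
    using has_derivative_divide'[OF G' has_derivative_of_real[OF N']] gap by fastforce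
  then obtain Q' where Q': "((\<lambda>w. G w / of_real (hartogs_gap i\<^sub>0 F w)) has_derivative Q') (at z)" ..
  have "d_z \<alpha> (d_zbar \<beta> (\<lambda>w. of_real (A ((cmod (w $ i\<^sub>0))\<^sup>2) - c * ln (hartogs_gap i\<^sub>0 F w)))) z
      = d_z \<alpha> (\<lambda>w. R w - of_real c * (G w / of_real (hartogs_gap i\<^sub>0 F w))) z"
    by (rule d_z_cong_open[OF T]) (use zS gap first in auto)
  also have "\<dots> = d_z \<alpha> R z - of_real c * d_z \<alpha> (\<lambda>w. G w / of_real (hartogs_gap i\<^sub>0 F w)) z"
    unfolding d_z_has_derivative[OF R'] d_z_has_derivative[OF Q']
      d_z_has_derivative[OF has_derivative_diff[OF R' has_derivative_mult_right[OF Q']]]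
    by (simp add: algebra_simps diff_divide_distrib add_divide_distrib)
  also have "d_z \<alpha> (\<lambda>w. G w / of_real (hartogs_gap i\<^sub>0 F w)) z
      = - hess_log_gap i\<^sub>0 F F1 F2 z \<alpha> \<beta>"
    using gap unfolding d_z_divide_of_real[OF G' N' gap[THEN less_imp_neq, symmetric]] dG hess_log_gap_def
    by (simp add: G_def minus_divide_left del: divide_minus_left)
  finally show ?thesis by (simp add: dR)
qed

section \<open>Determinant and Ricci tensor\<close>

text \<open>
  A permutation that fixes every index except \<open>k\<close> is the identity, so in the Leibniz formula
  only the diagonal term survives.
\<close>

lemma det_row_replaced_diagonal:
  fixes d :: "'n::finite \<Rightarrow> 'a::comm_ring_1" and v :: "'a^'n"
  shows "det (\<chi> i. if i = k then v else d i *s axis i 1) = v $ k * (\<Prod>i\<in>UNIV - {k}. d i)"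
proof -
  let ?A = "(\<chi> i. if i = k then v else d i *s axis i 1) :: 'a^'n^'n"
  have "det ?A = (\<Sum>p\<in>{id}. of_int (sign p) * (\<Prod>i\<in>UNIV. ?A $ i $ p i))"
    unfolding det_def
  proof (rule sum.mono_neutral_right)
    show "finite {p. p permutes (UNIV::'n set)}"
      by (simp add: finite_permutations)
    show "{id} \<subseteq> {p. p permutes (UNIV::'n set)}"
      by (simp add: permutes_id)
    show "\<forall>p\<in>{p. p permutes UNIV} - {id}. of_int (sign p) * (\<Prod>i\<in>UNIV. ?A $ i $ p i) = 0"
    proof
      fix p :: "'n \<Rightarrow> 'n" assume "p \<in> {p. p permutes UNIV} - {id}"
      then have p: "p permutes UNIV" "p \<noteq> id" by auto
      have "\<exists>i. i \<noteq> k \<and> p i \<noteq> i"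
      proof (rule ccontr)
        assume "\<not> ?thesis"
        then have fix_others: "p i = i" if "i \<noteq> k" for i using that by blast
        have "p k = k"
        proof (rule ccontr)
          assume "p k \<noteq> k"
          then have "p (p k) = p k" by (rule fix_others)
          with permutes_inj[OF p(1)] \<open>p k \<noteq> k\<close> show False by (auto dest: injD)
        qed
        with fix_others have "p = id" by (metis ext id_apply)
        with p(2) show False ..
      qed
      then obtain i where "i \<noteq> k" "p i \<noteq> i" by blast
      then have "?A $ i $ p i = 0" by (simp add: axis_def)
      then have "(\<Prod>i\<in>UNIV. ?A $ i $ p i) = 0"
        by (intro prod_zero bexI[of _ i]) simp_all
      then show "of_int (sign p) * (\<Prod>i\<in>UNIV. ?A $ i $ p i) = 0" by simp
    qed
  qed
  also have "\<dots> = (\<Prod>i\<in>UNIV. ?A $ i $ i)" by (simp add: sign_id)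
  also have "\<dots> = ?A $ k $ k * (\<Prod>i\<in>UNIV - {k}. ?A $ i $ i)"
    by (rule prod.remove) auto
  also have "(\<Prod>i\<in>UNIV - {k}. ?A $ i $ i) = (\<Prod>i\<in>UNIV - {k}. d i)"
    by (intro prod.cong) (auto simp: axis_def)
  finally show ?thesis by simp
qed

text \<open>
  With \<open>v\<close> already present as row \<open>k\<close>, adding multiples of \<open>v\<close> to the other rows does not
  change the determinant.
\<close>

lemma det_row_replaced_rank_one_update:
  fixes d u :: "'n::finite \<Rightarrow> 'a::comm_ring_1" and v :: "'a^'n"
  assumes "finite S" "k \<notin> S"
  shows "det (\<chi> i. if i = k then v else d i *s axis i 1 + (if i \<in> S then u i else 0) *s v)
    = v $ k * (\<Prod>i\<in>UNIV - {k}. d i)"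
  using assms
proof (induction S rule: finite_induct)
  case empty
  then show ?case using det_row_replaced_diagonal[of k v d] by (simp cong: if_cong)
next
  case (insert l S)
  let ?r = "\<lambda>S i. if i = k then v else d i *s axis i 1 + (if i \<in> S then u i else 0) *s v"
  have "det (\<chi> i. ?r (insert l S) i)
      = det (\<chi> i. if i = l then d l *s axis l 1 + u l *s v else ?r S i)"
    using insert by (intro arg_cong[of _ _ det]) (auto simp: vec_eq_iff)
  also have "\<dots> = det (\<chi> i. if i = l then d l *s axis l 1 else ?r S i)
      + det (\<chi> i. if i = l then u l *s v else ?r S i)"
    by (rule det_row_add)
  also have "det (\<chi> i. if i = l then u l *s v else ?r S i)
      = u l * det (\<chi> i. if i = l then v else ?r S i)"
    by (rule det_row_mul)
  also have "det (\<chi> i. if i = l then v else ?r S i) = 0"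
    by (rule det_identical_rows[of l k]) (use insert in \<open>auto simp: row_def vec_eq_iff\<close>)
  also have "(\<chi> i. if i = l then d l *s axis l 1 else ?r S i) = (\<chi> i. ?r S i)"
    using insert by (auto simp: vec_eq_iff)
  finally show ?case using insert by simp
qed

text \<open>
  The matrix determinant lemma, in a form that allows zeros on the diagonal. The rank one
  part is added row by row; each new row contributes one summand by multilinearity.
\<close>

lemma det_diagonal_plus_rank_one:
  fixes d u v :: "'n::finite \<Rightarrow> 'a::comm_ring_1"
  shows "det (\<chi> i j. (if i = j then d i else 0) + u i * v j)
    = (\<Prod>i\<in>UNIV. d i) + (\<Sum>k\<in>UNIV. u k * v k * (\<Prod>i\<in>UNIV - {k}. d i))"
proof -
  let ?v = "(\<chi> j. v j) :: 'a^'n"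
  let ?r = "\<lambda>S i. d i *s axis i 1 + (if i \<in> S then u i else 0) *s ?v"
  have "det (\<chi> i. ?r S i) = (\<Prod>i\<in>UNIV. d i) + (\<Sum>k\<in>S. u k * v k * (\<Prod>i\<in>UNIV - {k}. d i))"
    if "finite S" for S
    using that
  proof (induction S rule: finite_induct)
    case empty
    have "det (\<chi> i. ?r {} i) = (\<Prod>i\<in>UNIV. (\<chi> i. ?r {} i) $ i $ i)"
      by (rule det_diagonal) (simp add: axis_def)
    then show ?case by simp
  next
    case (insert k S)
    have "det (\<chi> i. ?r (insert k S) i)
        = det (\<chi> i. if i = k then d k *s axis k 1 + u k *s ?v else ?r S i)"
      using insert by (intro arg_cong[of _ _ det]) (auto simp: vec_eq_iff)
    also have "\<dots> = det (\<chi> i. if i = k then d k *s axis k 1 else ?r S i)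
        + det (\<chi> i. if i = k then u k *s ?v else ?r S i)"
      by (rule det_row_add)
    also have "det (\<chi> i. if i = k then u k *s ?v else ?r S i)
        = u k * det (\<chi> i. if i = k then ?v else ?r S i)"
      by (rule det_row_mul)
    also have "det (\<chi> i. if i = k then ?v else ?r S i) = v k * (\<Prod>i\<in>UNIV - {k}. d i)"
      using det_row_replaced_rank_one_update[OF insert(1,2), of ?v d u] by simp
    also have "(\<chi> i. if i = k then d k *s axis k 1 else ?r S i) = (\<chi> i. ?r S i)"
      using insert by (auto simp: vec_eq_iff)
    finally show ?case using insert by (simp add: algebra_simps)
  qed
  from this[of UNIV] have "det (\<chi> i. ?r UNIV i)
      = (\<Prod>i\<in>UNIV. d i) + (\<Sum>k\<in>UNIV. u k * v k * (\<Prod>i\<in>UNIV - {k}. d i))" by simp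
  moreover have "(\<chi> i. ?r UNIV i) = (\<chi> i j. (if i = j then d i else 0) + u i * v j)"
    by (auto simp: vec_eq_iff axis_def)
  ultimately show ?thesis by simp
qed

text \<open>
  This is \<open>- F\<^sup>2 (x F'/F)'\<close>, the part of the determinant of the metric which depends on \<open>z\<^sub>0\<close>
  alone.
\<close>

definition hartogs_psi :: "(real \<Rightarrow> real) \<Rightarrow> (real \<Rightarrow> real) \<Rightarrow> (real \<Rightarrow> real) \<Rightarrow> real \<Rightarrow> real" where
  "hartogs_psi F F1 F2 x = x * (F1 x)\<^sup>2 - F x * (F1 x + x * F2 x)"

text \<open>
  The Hessian of \<open>- log N\<close> is the diagonal matrix \<open>- \<partial>\<partial>bar N / N\<close> plus the rank one matrix
  \<open>\<partial>N \<otimes> \<partial>bar N / N\<^sup>2\<close>.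
\<close>

lemma det_hess_log_gap:
  fixes z :: "complex^'n::finite"
  assumes "hartogs_gap i\<^sub>0 F z \<noteq> 0"
  shows "det (\<chi> \<alpha> \<beta>. hess_log_gap i\<^sub>0 F F1 F2 z \<alpha> \<beta>)
    = of_real (hartogs_psi F F1 F2 ((cmod (z $ i\<^sub>0))\<^sup>2) / hartogs_gap i\<^sub>0 F z ^ (CARD('n) + 1))"
proof -
  \<comment> \<open>Up to the factor \<open>1/N\<close>, all diagonal entries except the one at \<open>i\<^sub>0\<close> are \<open>1\<close>.\<close>
  define x where "x = (cmod (z $ i\<^sub>0))\<^sup>2"
  define y where "y = (\<Sum>k\<in>UNIV - {i\<^sub>0}. (cmod (z $ k))\<^sup>2)"
  define N where "N = hartogs_gap i\<^sub>0 F z"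
  define e where "e = - (F1 x + x * F2 x)"
  define d where "d \<alpha> = complex_of_real (if \<alpha> = i\<^sub>0 then e / N else 1 / N)" for \<alpha>
  let ?b = "gap_dbar i\<^sub>0 F1 z"
  define u where "u \<alpha> = cnj (?b \<alpha>) / of_real N" for \<alpha>
  define v where "v \<alpha> = ?b \<alpha> / of_real N" for \<alpha>
  have N: "N \<noteq> 0" "F x = N + y" using assms by (auto simp: N_def hartogs_gap_def x_def y_def)
  obtain m where m: "CARD('n) = Suc m" by (metis card_eq_0_iff finite_class.finite_UNIV UNIV_not_empty not0_implies_Suc)
  have entry: "hess_log_gap i\<^sub>0 F F1 F2 z \<alpha> \<beta> = (if \<alpha> = \<beta> then d \<alpha> else 0) + u \<alpha> * v \<beta>" for \<alpha> \<beta>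
    using N(1) by (simp add: hess_log_gap_def d_def u_def v_def flip: N_def x_def)
      (simp add: e_def power2_eq_square divide_simps, simp add: algebra_simps)
  have d_others: "(\<Prod>i\<in>UNIV - {i\<^sub>0}. d i) = of_real ((1 / N) ^ m)"
  proof -
    have "(\<Prod>i\<in>UNIV - {i\<^sub>0}. d i) = (\<Prod>i\<in>UNIV - {i\<^sub>0}. of_real (1 / N))"
      by (intro prod.cong) (auto simp: d_def)
    then show ?thesis by (simp add: m)
  qed
  have d_all: "(\<Prod>i\<in>UNIV. d i) = of_real (e / N * (1 / N) ^ m)"
    by (subst prod.remove[of _ i\<^sub>0]) (simp_all add: d_others, simp add: d_def)
  have d_but: "(\<Prod>i\<in>UNIV - {k}. d i) = of_real (N * (e / N * (1 / N) ^ m))" if "k \<noteq> i\<^sub>0" for k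
  proof -
    have "(\<Prod>i\<in>UNIV. d i) = d k * (\<Prod>i\<in>UNIV - {k}. d i)"
      by (rule prod.remove) auto
    then have "of_real N * (\<Prod>i\<in>UNIV. d i) = (of_real N * d k) * (\<Prod>i\<in>UNIV - {k}. d i)"
      by (simp add: mult.assoc)
    also have "of_real N * d k = 1" using that N by (simp add: d_def)
    finally show ?thesis by (simp only: d_all of_real_mult mult_1_left)
  qed
  have uv0: "u i\<^sub>0 * v i\<^sub>0 = of_real (x * (F1 x)\<^sup>2 / N\<^sup>2)"
  proof -
    have "cnj (z $ i\<^sub>0) * z $ i\<^sub>0 = of_real x"
      unfolding x_def by (metis complex_norm_square mult.commute)
    moreover have "u i\<^sub>0 * v i\<^sub>0 = (cnj (z $ i\<^sub>0) * z $ i\<^sub>0) * (of_real (F1 x))\<^sup>2 / (of_real N)\<^sup>2"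
      by (simp add: u_def v_def gap_dbar_def flip: x_def) (simp add: power2_eq_square)
    ultimately show ?thesis by simp
  qed
  have uv: "u k * v k = of_real ((cmod (z $ k))\<^sup>2 / N\<^sup>2)" if "k \<noteq> i\<^sub>0" for k
    using that by (simp only: of_real_divide complex_norm_square u_def v_def gap_dbar_def)
      (simp add: power2_eq_square)
  have "det (\<chi> \<alpha> \<beta>. hess_log_gap i\<^sub>0 F F1 F2 z \<alpha> \<beta>)
      = (\<Prod>i\<in>UNIV. d i) + (\<Sum>k\<in>UNIV. u k * v k * (\<Prod>i\<in>UNIV - {k}. d i))"
    unfolding entry by (rule det_diagonal_plus_rank_one)
  also have "(\<Sum>k\<in>UNIV. u k * v k * (\<Prod>i\<in>UNIV - {k}. d i))
      = u i\<^sub>0 * v i\<^sub>0 * (\<Prod>i\<in>UNIV - {i\<^sub>0}. d i)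
        + (\<Sum>k\<in>UNIV - {i\<^sub>0}. u k * v k * (\<Prod>i\<in>UNIV - {k}. d i))"
    by (rule sum.remove) auto
  also have "(\<Sum>k\<in>UNIV - {i\<^sub>0}. u k * v k * (\<Prod>i\<in>UNIV - {k}. d i))
      = (\<Sum>k\<in>UNIV - {i\<^sub>0}. of_real ((cmod (z $ k))\<^sup>2 * (1 / N\<^sup>2 * (N * (e / N * (1 / N) ^ m)))))"
    by (intro sum.cong refl) (simp add: uv d_but)
  also have "\<dots> = of_real (y * (1 / N\<^sup>2 * (N * (e / N * (1 / N) ^ m))))"
    by (simp only: y_def sum_distrib_right of_real_sum)
  finally have "det (\<chi> \<alpha> \<beta>. hess_log_gap i\<^sub>0 F F1 F2 z \<alpha> \<beta>)
      = of_real (e / N * (1 / N) ^ m + (x * (F1 x)\<^sup>2 / N\<^sup>2 * (1 / N) ^ m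
          + y * (1 / N\<^sup>2 * (N * (e / N * (1 / N) ^ m)))))"
    by (simp only: d_all d_others uv0 of_real_add of_real_mult)
  also have "e / N * (1 / N) ^ m + (x * (F1 x)\<^sup>2 / N\<^sup>2 * (1 / N) ^ m
          + y * (1 / N\<^sup>2 * (N * (e / N * (1 / N) ^ m)))) = (x * (F1 x)\<^sup>2 + F x * e) / N ^ (m + 2)"
    using N by (simp add: field_simps power2_eq_square)
  also have "x * (F1 x)\<^sup>2 + F x * e = hartogs_psi F F1 F2 x"
    by (simp add: hartogs_psi_def e_def algebra_simps)
  finally show ?thesis by (simp add: m N_def x_def)
qed

lemma hartogs_metric_eq_hess_log_gap:
  fixes z :: "complex^'n::finite"
  assumes S: "open S" and zS: "(cmod (z $ i\<^sub>0))\<^sup>2 \<in> S" and gap: "hartogs_gap i\<^sub>0 F z > 0"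
    and F: "\<And>x. x \<in> S \<Longrightarrow> (F has_real_derivative F1 x) (at x)"
    and F1: "\<And>x. x \<in> S \<Longrightarrow> (F1 has_real_derivative F2 x) (at x)"
  shows "hartogs_metric i\<^sub>0 F z = (\<chi> \<alpha> \<beta>. hess_log_gap i\<^sub>0 F F1 F2 z \<alpha> \<beta>)"
proof -
  let ?T = "{w::complex^'n. (cmod (w $ i\<^sub>0))\<^sup>2 \<in> S \<and> hartogs_gap i\<^sub>0 F w > 0}"
  have T: "open ?T" by (rule open_hartogs_gap_pos[OF S F])
  have pot: "hartogs_potential i\<^sub>0 F w = 0 - 1 * ln (hartogs_gap i\<^sub>0 F w)" if "w \<in> ?T" for w
    using that by (simp add: hartogs_potential_def ln_div flip: hartogs_gap_def)
  have "d_z \<alpha> (d_zbar \<beta> (\<lambda>w. of_real (hartogs_potential i\<^sub>0 F w))) z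
      = d_z \<alpha> (d_zbar \<beta> (\<lambda>w. of_real (0 - 1 * ln (hartogs_gap i\<^sub>0 F w)))) z" for \<alpha> \<beta>
    by (intro d_z_cong_open[OF T] d_zbar_cong_open[OF T]) (use zS gap pot in auto)
  also have "d_z \<alpha> (d_zbar \<beta> (\<lambda>w. of_real (0 - 1 * ln (hartogs_gap i\<^sub>0 F w)))) z
      = hess_log_gap i\<^sub>0 F F1 F2 z \<alpha> \<beta>" for \<alpha> \<beta>
    using ddbar_radial_minus_log_gap[OF S zS gap F F1, of "\<lambda>_. 0" "\<lambda>_. 0" "\<lambda>_. 0" \<alpha> \<beta> 1]
    by simp
  finally show ?thesis by (simp add: hartogs_metric_def vec_eq_iff)
qed

text \<open>
  \<open>log det g = log \<psi>(|z\<^sub>0|\<^sup>2) - (n+1) log N\<close>, and the second summand is \<open>n+1\<close> times the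
  potential. For a radial function \<open>A(|z\<^sub>0|\<^sup>2)\<close> one has \<open>\<partial>\<^sub>0\<partial>\<^sub>0bar A = A' + x A''\<close>.
\<close>

lemma ricci_hartogs_metric:
  fixes z :: "complex^'n::finite"
  assumes S: "open S" and zS: "(cmod (z $ i\<^sub>0))\<^sup>2 \<in> S" and gap: "hartogs_gap i\<^sub>0 F z > 0"
    and F: "\<And>x. x \<in> S \<Longrightarrow> (F has_real_derivative F1 x) (at x)"
    and F1: "\<And>x. x \<in> S \<Longrightarrow> (F1 has_real_derivative F2 x) (at x)"
    and psi: "\<And>x. x \<in> S \<Longrightarrow> hartogs_psi F F1 F2 x > 0"
    and A: "\<And>x. x \<in> S \<Longrightarrow> ((\<lambda>x. ln (hartogs_psi F F1 F2 x)) has_real_derivative A1 x) (at x)"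
    and A1: "\<And>x. x \<in> S \<Longrightarrow> (A1 has_real_derivative A2 x) (at x)"
  shows "ricci (hartogs_metric i\<^sub>0 F) z $ \<alpha> $ \<beta>
    = - (of_nat (CARD('n) + 1) * hess_log_gap i\<^sub>0 F F1 F2 z \<alpha> \<beta>)
      - (if \<alpha> = i\<^sub>0 \<and> \<beta> = i\<^sub>0
         then of_real (A1 ((cmod (z $ i\<^sub>0))\<^sup>2) + (cmod (z $ i\<^sub>0))\<^sup>2 * A2 ((cmod (z $ i\<^sub>0))\<^sup>2)) else 0)"
proof -
  let ?T = "{w::complex^'n. (cmod (w $ i\<^sub>0))\<^sup>2 \<in> S \<and> hartogs_gap i\<^sub>0 F w > 0}"
  let ?A = "\<lambda>x. ln (hartogs_psi F F1 F2 x)"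
  have T: "open ?T" by (rule open_hartogs_gap_pos[OF S F])
  have log_det: "ln (det (hartogs_metric i\<^sub>0 F w))
      = of_real (?A ((cmod (w $ i\<^sub>0))\<^sup>2) - real (CARD('n) + 1) * ln (hartogs_gap i\<^sub>0 F w))"
    if w: "w \<in> ?T" for w
  proof -
    let ?p = "hartogs_psi F F1 F2 ((cmod (w $ i\<^sub>0))\<^sup>2)" and ?N = "hartogs_gap i\<^sub>0 F w"
    have pos: "?p > 0" "?N > 0" using w psi by auto
    have "det (hartogs_metric i\<^sub>0 F w) = of_real (?p / ?N ^ (CARD('n) + 1))"
      using hartogs_metric_eq_hess_log_gap[OF S _ _ F F1, of w i\<^sub>0]
        det_hess_log_gap[of i\<^sub>0 F w F1 F2] w by simp
    then have "ln (det (hartogs_metric i\<^sub>0 F w)) = of_real (ln (?p / ?N ^ (CARD('n) + 1)))"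
      using pos by (simp only: Ln_of_real divide_pos_pos zero_less_power)
    also have "ln (?p / ?N ^ (CARD('n) + 1)) = ?A ((cmod (w $ i\<^sub>0))\<^sup>2) - real (CARD('n) + 1) * ln ?N"
      using pos by (simp only: ln_divide_pos zero_less_power ln_realpow)
    finally show ?thesis .
  qed
  have "d_z \<alpha> (d_zbar \<beta> (\<lambda>w. ln (det (hartogs_metric i\<^sub>0 F w)))) z
      = d_z \<alpha> (d_zbar \<beta> (\<lambda>w. of_real (?A ((cmod (w $ i\<^sub>0))\<^sup>2)
          - real (CARD('n) + 1) * ln (hartogs_gap i\<^sub>0 F w)))) z"
    by (intro d_z_cong_open[OF T] d_zbar_cong_open[OF T]) (use zS gap log_det in auto)
  also have "\<dots> = (if \<alpha> = i\<^sub>0 \<and> \<beta> = i\<^sub>0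
         then of_real (A1 ((cmod (z $ i\<^sub>0))\<^sup>2) + (cmod (z $ i\<^sub>0))\<^sup>2 * A2 ((cmod (z $ i\<^sub>0))\<^sup>2)) else 0)
      + of_real (real (CARD('n) + 1)) * hess_log_gap i\<^sub>0 F F1 F2 z \<alpha> \<beta>"
    by (rule ddbar_radial_minus_log_gap[OF S zS gap F F1 A A1])
  finally show ?thesis by (simp add: ricci_def)
qed

section \<open>Means over circles\<close>

lemma has_integral_Re: "(f has_integral i) A \<Longrightarrow> ((\<lambda>t. Re (f t)) has_integral Re i) A"
  using has_integral_linear[OF _ bounded_linear_Re] by (simp add: o_def)

lemma holomorphic_on_if_has_derivative:
  "(\<And>z. z \<in> A \<Longrightarrow> (f has_field_derivative f' z) (at z)) \<Longrightarrow> f holomorphic_on A"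
  unfolding holomorphic_on_def field_differentiable_def using has_field_derivative_at_within by blast

text \<open>
  Cauchy's formula for the Taylor coefficients, written as a mean over the circle with the
  parameter normalised to \<open>[0,1]\<close>.
\<close>

lemma circle_mean_divide_power:
  assumes "0 < r" "continuous_on (cball 0 r) f" "f holomorphic_on ball 0 r"
  shows "((\<lambda>t. f (circlepath 0 r t) / circlepath 0 r t ^ k) has_integral
    (deriv ^^ k) f 0 / fact k) {0..1}"
proof -
  have "((\<lambda>u. f u / (u - 0) ^ Suc k) has_contour_integral
      (2 * pi * \<i>) / fact k * (deriv ^^ k) f 0) (circlepath 0 r)"
    by (rule Cauchy_has_contour_integral_higher_derivative_circlepath) (use assms in auto)
  then have "((\<lambda>t. f (circlepath 0 r t) / circlepath 0 r t ^ Suc k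
        * vector_derivative (circlepath 0 r) (at t within {0..1})) has_integral
      (2 * pi * \<i>) / fact k * (deriv ^^ k) f 0) {0..1}"
    by (simp add: has_contour_integral_def)
  moreover have "f (circlepath 0 r t) / circlepath 0 r t ^ Suc k
        * vector_derivative (circlepath 0 r) (at t within {0..1})
      = (2 * pi * \<i>) * (f (circlepath 0 r t) / circlepath 0 r t ^ k)" if "t \<in> {0..1}" for t
    using that assms(1) by (simp add: vector_derivative_circlepath01) (simp add: circlepath)
  ultimately have "((\<lambda>t. (2 * pi * \<i>) * (f (circlepath 0 r t) / circlepath 0 r t ^ k)) has_integral
      (2 * pi * \<i>) / fact k * (deriv ^^ k) f 0) {0..1}"
    by (rule has_integral_eq[rotated])
  from has_integral_mult_right[OF this, of "1 / (2 * pi * \<i>)"] show ?thesis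
    by simp
qed

lemma norm_circlepath_0 [simp]: "0 \<le> r \<Longrightarrow> cmod (circlepath 0 r t) = r"
  by (simp add: circlepath norm_mult)

lemma circle_mean:
  assumes "0 < r" "f holomorphic_on cball 0 r"
  shows "((\<lambda>t. f (circlepath 0 r t)) has_integral f 0) {0..1}"
proof -
  have "continuous_on (cball 0 r) f" "f holomorphic_on ball 0 r"
    using assms by (auto intro: holomorphic_on_imp_continuous_on holomorphic_on_subset)
  from circle_mean_divide_power[OF assms(1) this, of 0] show ?thesis
    by simp
qed

text \<open>
  On the circle of radius \<open>r\<close> the conjugate of \<open>\<zeta>\<close> is \<open>r\<^sup>2 / \<zeta>\<close>, so this mean picks the
  linear Taylor coefficient.
\<close>

lemma circle_mean_cnj_times:
  assumes "0 < r" "f holomorphic_on cball 0 r"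
  shows "((\<lambda>t. cnj (circlepath 0 r t) * f (circlepath 0 r t)) has_integral r\<^sup>2 * deriv f 0) {0..1}"
proof -
  have "((\<lambda>t. r\<^sup>2 * (f (circlepath 0 r t) / circlepath 0 r t ^ 1)) has_integral
      r\<^sup>2 * ((deriv ^^ 1) f 0 / fact 1)) {0..1}"
    by (intro has_integral_mult_right circle_mean_divide_power)
      (use assms in \<open>auto intro: holomorphic_on_imp_continuous_on holomorphic_on_subset\<close>)
  moreover have "r\<^sup>2 * (f (circlepath 0 r t) / circlepath 0 r t ^ 1)
      = cnj (circlepath 0 r t) * f (circlepath 0 r t)" for t
  proof -
    have "circlepath 0 r t \<noteq> 0" using assms(1) by (simp add: circlepath)
    moreover have "complex_of_real (r\<^sup>2) = circlepath 0 r t * cnj (circlepath 0 r t)"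
      using complex_norm_square[of "circlepath 0 r t"] assms(1) by simp
    ultimately show ?thesis by simp
  qed
  ultimately show ?thesis by simp
qed

section \<open>The soliton equation in coordinates\<close>

lemma tensor_axis_right: "tensor h v (axis b 1) = Re (\<Sum>\<alpha>\<in>UNIV. h $ \<alpha> $ b * v $ \<alpha>)"
proof -
  have "(\<Sum>\<beta>\<in>UNIV. h $ \<alpha> $ \<beta> * v $ \<alpha> * cnj (axis b 1 $ \<beta>)) = h $ \<alpha> $ b * v $ \<alpha>" for \<alpha>
  proof -
    have "(\<Sum>\<beta>\<in>UNIV. h $ \<alpha> $ \<beta> * v $ \<alpha> * cnj (axis b 1 $ \<beta>))
        = (\<Sum>\<beta>\<in>UNIV. if \<beta> = b then h $ \<alpha> $ b * v $ \<alpha> else 0)"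
      by (intro sum.cong) (auto simp: axis_def)
    then show ?thesis by simp
  qed
  then show ?thesis by (simp add: tensor_def)
qed

lemma tensor_axis_left: "tensor h (axis a 1) w = Re (\<Sum>\<beta>\<in>UNIV. h $ a $ \<beta> * cnj (w $ \<beta>))"
proof -
  have "(\<Sum>\<alpha>\<in>UNIV. \<Sum>\<beta>\<in>UNIV. h $ \<alpha> $ \<beta> * axis a 1 $ \<alpha> * cnj (w $ \<beta>))
      = (\<Sum>\<alpha>\<in>UNIV. if \<alpha> = a then \<Sum>\<beta>\<in>UNIV. h $ a $ \<beta> * cnj (w $ \<beta>) else 0)"
    by (intro sum.cong) (auto simp: axis_def)
  then show ?thesis by (simp add: tensor_def)
qed

lemma tensor_axis_axis: "tensor h (axis a 1) (axis b 1) = Re (h $ a $ b)"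
proof -
  have "(\<Sum>\<alpha>\<in>UNIV. h $ \<alpha> $ b * axis a 1 $ \<alpha>) = (\<Sum>\<alpha>\<in>UNIV. if \<alpha> = a then h $ a $ b else 0)"
    by (intro sum.cong) (auto simp: axis_def)
  then show ?thesis by (simp add: tensor_axis_right)
qed

lemma Ck_on_real_derivative:
  fixes f :: "real \<Rightarrow> real"
  assumes "Ck_on (Suc k) A f"
  obtains f' where "\<And>x. x \<in> A \<Longrightarrow> (f has_real_derivative f' x) (at x)" "Ck_on k A f'"
proof
  fix x assume "x \<in> A"
  then have D: "(f has_derivative frechet_derivative f (at x)) (at x)"
    using assms by (simp add: frechet_derivative_works)
  have "frechet_derivative f (at x) v = frechet_derivative f (at x) 1 * v" for v
    using linear_scale[OF has_derivative_linear[OF D], of v 1] by simp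
  then have "frechet_derivative f (at x) = (*) (frechet_derivative f (at x) 1)" by (rule ext)
  with D show "(f has_real_derivative frechet_derivative f (at x) 1) (at x)"
    by (simp only: has_field_derivative_def)
next
  show "Ck_on k A (\<lambda>x. frechet_derivative f (at x) 1)" using assms by simp
qed

lemma smooth_on_const: "smooth_on D (\<lambda>_. c)"
proof -
  have "Ck_on k D (\<lambda>_. c)" for k and c :: 'b
    by (induction k arbitrary: c) simp_all
  then show ?thesis by (simp add: smooth_on_def)
qed

lemma bounded_linear_axis: "bounded_linear (axis k :: complex \<Rightarrow> complex^'m::finite)"
proof (rule bounded_linear_intro[where K = 1])
  fix x :: complex
  have "norm (axis k x :: complex^'m) = sqrt (\<Sum>i\<in>UNIV. if i = k then (cmod x)\<^sup>2 else 0)"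
    unfolding norm_vec_def L2_set_def by (intro arg_cong[of _ _ sqrt] sum.cong) (auto simp: axis_def)
  then show "norm (axis k x :: complex^'m) \<le> norm x * 1" by simp
qed (simp_all add: vec_eq_iff axis_def)

text \<open>
  The notion of a holomorphic map is componentwise; the components of the differential are
  assembled here.
\<close>

lemma holo_map_on_has_derivative:
  fixes X :: "complex^'n \<Rightarrow> complex^'m::finite"
  assumes "holo_map_on D X" "z \<in> D"
  shows "(X has_derivative frechet_derivative X (at z)) (at z)"
    and "frechet_derivative X (at z) (c *s v) = c *s frechet_derivative X (at z) v"
proof -
  have "\<forall>k. \<exists>f'. ((\<lambda>w. X w $ k) has_derivative f') (at z) \<and> (\<forall>c v. f' (c *s v) = c * f' v)"
    using assms by (simp add: holo_map_on_def holo_fun_on_def)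
  then obtain f' where f': "\<And>k. ((\<lambda>w. X w $ k) has_derivative f' k) (at z)"
    and lin: "\<And>k c v. f' k (c *s v) = c * f' k v" by metis
  have "((\<lambda>w. X w) has_derivative (\<lambda>v. \<chi> k. f' k v)) (at z)"
  proof -
    from bounded_linear.has_derivative[OF bounded_linear_axis f']
    have "((\<lambda>w. \<Sum>k\<in>UNIV. axis k (X w $ k)) has_derivative (\<lambda>v. \<Sum>k\<in>UNIV. axis k (f' k v))) (at z)"
      by (intro has_derivative_sum)
    moreover have "(\<Sum>k\<in>UNIV. axis k (a k)) = (\<chi> k. a k)" for a :: "'m \<Rightarrow> complex"
    proof -
      have "(\<Sum>k\<in>UNIV. axis k (a k) $ l) = (\<Sum>k\<in>UNIV. if k = l then a l else 0)" for l
        by (intro sum.cong) (auto simp: axis_def)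
      then show ?thesis by (simp add: vec_eq_iff)
    qed
    ultimately show ?thesis by simp
  qed
  then have eq: "frechet_derivative X (at z) = (\<lambda>v. \<chi> k. f' k v)"
    and "X differentiable (at z)"
    by (auto simp: frechet_derivative_at[symmetric] differentiable_def)
  then show "(X has_derivative frechet_derivative X (at z)) (at z)"
    by (simp add: frechet_derivative_works)
  show "frechet_derivative X (at z) (c *s v) = c *s frechet_derivative X (at z) v"
    by (simp add: eq lin vec_eq_iff)
qed

lemma open_ereal_less: "open {x::real. ereal x < c}"
  by (cases c) (auto simp flip: lessThan_def)

text \<open>
  The bracket of \<open>X\<close> with a constant field is minus the derivative of \<open>X\<close> in its direction,
  and by the Hermitian symmetry both bracket terms have the same real part.
\<close>

lemma lie_derivative_axis:
  assumes herm: "\<And>\<alpha> \<beta>. g z $ \<beta> $ \<alpha> = cnj (g z $ \<alpha> $ \<beta>)"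
    and X: "(X has_derivative frechet_derivative X (at z)) (at z)"
  shows "lie_derivative X g (\<lambda>_. axis m 1) (\<lambda>_. axis m 1) z
    = frechet_derivative (\<lambda>w. Re (g w $ m $ m)) (at z) (X z)
      + 2 * Re (\<Sum>\<alpha>\<in>UNIV. g z $ \<alpha> $ m * frechet_derivative X (at z) (axis m 1) $ \<alpha>)"
proof -
  let ?dX = "frechet_derivative X (at z) (axis m 1)"
  have br: "lie_bracket X (\<lambda>_. axis m 1) z = - ?dX"
    by (simp add: lie_bracket_def)
  have "Re (\<Sum>\<beta>\<in>UNIV. g z $ m $ \<beta> * cnj (?dX $ \<beta>)) = Re (\<Sum>\<alpha>\<in>UNIV. g z $ \<alpha> $ m * ?dX $ \<alpha>)"
  proof -
    have "(\<Sum>\<beta>\<in>UNIV. g z $ m $ \<beta> * cnj (?dX $ \<beta>)) = cnj (\<Sum>\<alpha>\<in>UNIV. g z $ \<alpha> $ m * ?dX $ \<alpha>)"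
      unfolding cnj_sum by (intro sum.cong refl) (simp, metis herm)
    then show ?thesis by simp
  qed
  then show ?thesis
    unfolding lie_derivative_def br by (simp add: tensor_axis_axis)
      (simp add: tensor_axis_left tensor_axis_right sum_negf)
qed

section \<open>Solitons on the slice of two coordinates\<close>

definition hartogs_psi' :: "(real \<Rightarrow> real) \<Rightarrow> (real \<Rightarrow> real) \<Rightarrow> (real \<Rightarrow> real) \<Rightarrow> (real \<Rightarrow> real) \<Rightarrow> real \<Rightarrow> real" where
  "hartogs_psi' F F1 F2 F3 x = x * F1 x * F2 x - F x * (2 * F2 x + x * F3 x)"

definition hartogs_psi'' :: "(real \<Rightarrow> real) \<Rightarrow> (real \<Rightarrow> real) \<Rightarrow> (real \<Rightarrow> real) \<Rightarrow> (real \<Rightarrow> real) \<Rightarrow>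
    (real \<Rightarrow> real) \<Rightarrow> real \<Rightarrow> real" where
  "hartogs_psi'' F F1 F2 F3 F4 x = x * (F2 x)\<^sup>2 - F1 x * F2 x - F x * (3 * F3 x + x * F4 x)"

lemma hartogs_psi_has_derivative:
  assumes "(F has_real_derivative F1 x) (at x)" "(F1 has_real_derivative F2 x) (at x)"
    "(F2 has_real_derivative F3 x) (at x)"
  shows "(hartogs_psi F F1 F2 has_real_derivative hartogs_psi' F F1 F2 F3 x) (at x)"
  unfolding hartogs_psi_def[abs_def] hartogs_psi'_def
  by (auto intro!: derivative_eq_intros assms) (simp add: algebra_simps power2_eq_square)

lemma hartogs_psi'_has_derivative:
  assumes "(F has_real_derivative F1 x) (at x)" "(F1 has_real_derivative F2 x) (at x)"
    "(F2 has_real_derivative F3 x) (at x)" "(F3 has_real_derivative F4 x) (at x)"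
  shows "(hartogs_psi' F F1 F2 F3 has_real_derivative hartogs_psi'' F F1 F2 F3 F4 x) (at x)"
  unfolding hartogs_psi'_def[abs_def] hartogs_psi''_def
  by (auto intro!: derivative_eq_intros assms) (simp add: algebra_simps power2_eq_square)

text \<open>
  The derivatives \<open>F1, \<dots>, F4\<close> are parameters because only their values on \<open>(0, x\<^sub>0)\<close> are
  determined. Four derivatives enter through the Laplacian of \<open>log \<psi>\<close>. The index \<open>j\<close> is any
  coordinate other than \<open>z\<^sub>0\<close>.
\<close>

locale hartogs_soliton =
  fixes i\<^sub>0 j :: "'n::finite" and x\<^sub>0 :: ereal and F F1 F2 F3 F4 :: "real \<Rightarrow> real"
    and X :: "complex^'n \<Rightarrow> complex^'n" and \<Lambda> :: real
  assumes other: "j \<noteq> i\<^sub>0"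
    and spc: "strongly_pseudoconvex_hartogs i\<^sub>0 x\<^sub>0 F"
    and F: "\<And>x. 0 < x \<Longrightarrow> ereal x < x\<^sub>0 \<Longrightarrow> (F has_real_derivative F1 x) (at x)"
    and F1: "\<And>x. 0 < x \<Longrightarrow> ereal x < x\<^sub>0 \<Longrightarrow> (F1 has_real_derivative F2 x) (at x)"
    and F2: "\<And>x. 0 < x \<Longrightarrow> ereal x < x\<^sub>0 \<Longrightarrow> (F2 has_real_derivative F3 x) (at x)"
    and F3: "\<And>x. 0 < x \<Longrightarrow> ereal x < x\<^sub>0 \<Longrightarrow> (F3 has_real_derivative F4 x) (at x)"
    and holo: "holo_map_on (hartogs_domain i\<^sub>0 x\<^sub>0 F) X"
    and soliton: "\<And>Y Z z. smooth_on (hartogs_domain i\<^sub>0 x\<^sub>0 F) Y \<Longrightarrow>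
        smooth_on (hartogs_domain i\<^sub>0 x\<^sub>0 F) Z \<Longrightarrow> z \<in> hartogs_domain i\<^sub>0 x\<^sub>0 F \<Longrightarrow>
        tensor (ricci (hartogs_metric i\<^sub>0 F) z) (Y z) (Z z)
          = \<Lambda> * tensor (hartogs_metric i\<^sub>0 F z) (Y z) (Z z)
            + lie_derivative X (hartogs_metric i\<^sub>0 F) Y Z z"
begin

abbreviation D where "D \<equiv> hartogs_domain i\<^sub>0 x\<^sub>0 F"
abbreviation S where "S \<equiv> {x. 0 < x \<and> ereal x < x\<^sub>0}"
abbreviation N where "N \<equiv> hartogs_gap i\<^sub>0 F"
abbreviation g where "g \<equiv> hartogs_metric i\<^sub>0 F"
abbreviation \<psi> where "\<psi> \<equiv> hartogs_psi F F1 F2"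
abbreviation \<psi>' where "\<psi>' \<equiv> hartogs_psi' F F1 F2 F3"
abbreviation \<psi>'' where "\<psi>'' \<equiv> hartogs_psi'' F F1 F2 F3 F4"
abbreviation H where "H \<equiv> hess_log_gap i\<^sub>0 F F1 F2"
abbreviation dX where "dX z \<equiv> frechet_derivative X (at z)"

definition slice :: "complex \<Rightarrow> complex \<Rightarrow> complex^'n" where
  "slice a \<zeta> = axis i\<^sub>0 a + axis j \<zeta>"

text \<open>
  The only nonzero component of \<open>\<partial>\<partial>bar log \<psi>(|z\<^sub>0|\<^sup>2)\<close>.
\<close>

definition log_psi_laplacian :: "real \<Rightarrow> real" where
  "log_psi_laplacian x = \<psi>' x / \<psi> x + x * ((\<psi>'' x * \<psi> x - (\<psi>' x)\<^sup>2) / (\<psi> x)\<^sup>2)"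

lemma open_S: "open S"
  using open_ereal_less[of x\<^sub>0] by (simp add: open_Collect_conj open_Collect_less)

lemma hartogs_F: "hartogs_function x\<^sub>0 F" and kaehler: "kaehler_metric_on D g"
  using spc by (auto simp: strongly_pseudoconvex_hartogs_def)

lemma x0_pos: "0 < x\<^sub>0"
  and F_pos: "0 \<le> x \<Longrightarrow> ereal x < x\<^sub>0 \<Longrightarrow> 0 < F x"
  using hartogs_F by (auto simp: hartogs_function_def)

lemma F_antimono: "0 \<le> x \<Longrightarrow> x \<le> y \<Longrightarrow> ereal y < x\<^sub>0 \<Longrightarrow> F y \<le> F x"
  using hartogs_F monotone_onD[of "{x. 0 \<le> x \<and> ereal x < x\<^sub>0}" "(\<le>)" "(\<ge>)" F x y]
    order.strict_trans1[of "ereal x" "ereal y" x\<^sub>0] by (simp add: hartogs_function_def)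

lemma in_D_iff: "z \<in> D \<longleftrightarrow> ereal ((cmod (z $ i\<^sub>0))\<^sup>2) < x\<^sub>0 \<and> N z > 0"
  by (auto simp: hartogs_domain_def hartogs_gap_def)

lemma open_D: "open D"
  using kaehler by (simp add: kaehler_metric_on_def)

lemma slice_nth [simp]: "slice a \<zeta> $ i\<^sub>0 = a" "slice a \<zeta> $ j = \<zeta>"
  "k \<noteq> i\<^sub>0 \<Longrightarrow> k \<noteq> j \<Longrightarrow> slice a \<zeta> $ k = 0"
  using other by (auto simp: slice_def axis_def)

lemma N_slice [simp]: "N (slice a \<zeta>) = F ((cmod a)\<^sup>2) - (cmod \<zeta>)\<^sup>2"
proof -
  have "(\<Sum>k\<in>UNIV - {i\<^sub>0}. (cmod (slice a \<zeta> $ k))\<^sup>2) = (\<Sum>k\<in>UNIV - {i\<^sub>0}. if k = j then (cmod \<zeta>)\<^sup>2 else 0)"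
    by (intro sum.cong refl) auto
  then show ?thesis using other by (simp add: hartogs_gap_def)
qed

lemma slice_in_D_iff: "slice a \<zeta> \<in> D \<longleftrightarrow> ereal ((cmod a)\<^sup>2) < x\<^sub>0 \<and> (cmod \<zeta>)\<^sup>2 < F ((cmod a)\<^sup>2)"
  by (simp add: in_D_iff)

lemma sum_eq_two_terms:
  assumes "\<And>k. k \<noteq> i\<^sub>0 \<Longrightarrow> k \<noteq> j \<Longrightarrow> f k = (0::complex)"
  shows "(\<Sum>k\<in>UNIV. f k) = f i\<^sub>0 + f j"
proof -
  have "(\<Sum>k\<in>UNIV. f k) = (\<Sum>k\<in>{i\<^sub>0, j}. f k)"
    by (rule sum.mono_neutral_right) (use assms in auto)
  then show ?thesis using other by simp
qed

lemma metric_eq: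
  assumes "z \<in> D" "z $ i\<^sub>0 \<noteq> 0"
  shows "g z $ \<alpha> $ \<beta> = H z \<alpha> \<beta>"
  using hartogs_metric_eq_hess_log_gap[OF open_S, of z i\<^sub>0 F F1 F2] assms F F1
  by (simp add: in_D_iff)

text \<open>
  \<open>\<psi>/F\<^sup>2\<close> is the squared length of \<open>\<partial>/\<partial>z\<^sub>0\<close> at points with \<open>z' = 0\<close>.
\<close>

lemma psi_pos:
  assumes "x \<in> S" shows "\<psi> x > 0"
proof -
  let ?a = "complex_of_real (sqrt x)" let ?z = "slice ?a 0"
  have x: "(cmod ?a)\<^sup>2 = x" "?a \<noteq> 0" "F x > 0" using assms F_pos by auto
  have z: "?z \<in> D" using assms x by (simp add: slice_in_D_iff)
  have "axis i\<^sub>0 1 \<noteq> (0 :: complex^'n)" by (simp add: axis_eq_0_iff)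
  then have "tensor (g ?z) (axis i\<^sub>0 1) (axis i\<^sub>0 1) > 0"
    using kaehler z by (auto simp: kaehler_metric_on_def)
  then have "Re (H ?z i\<^sub>0 i\<^sub>0) > 0"
    using metric_eq[OF z] x(2) by (simp add: tensor_axis_axis)
  also have "H ?z i\<^sub>0 i\<^sub>0 = of_real (\<psi> x / (F x)\<^sup>2)"
    using x(1) assms by (simp add: hess_log_gap_def gap_dbar_def hartogs_psi_def complex_eq_iff
        power2_eq_square)
  finally show ?thesis using x(3) by (simp add: zero_less_divide_iff)
qed

lemma log_psi_has_derivative:
  assumes "x \<in> S" shows "((\<lambda>x. ln (\<psi> x)) has_real_derivative \<psi>' x / \<psi> x) (at x)"
proof -
  have "(\<psi> has_real_derivative \<psi>' x) (at x)"
    using assms by (intro hartogs_psi_has_derivative F F1 F2) auto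
  from DERIV_chain2[OF DERIV_ln_divide[OF psi_pos[OF assms]] this] show ?thesis
    by simp
qed

lemma log_psi'_has_derivative:
  assumes "x \<in> S"
  shows "((\<lambda>x. \<psi>' x / \<psi> x) has_real_derivative (\<psi>'' x * \<psi> x - (\<psi>' x)\<^sup>2) / (\<psi> x)\<^sup>2) (at x)"
proof -
  have "(\<psi> has_real_derivative \<psi>' x) (at x)"
    using assms by (intro hartogs_psi_has_derivative F F1 F2) auto
  moreover have "(\<psi>' has_real_derivative \<psi>'' x) (at x)"
    using assms by (intro hartogs_psi'_has_derivative F F1 F2 F3) auto
  ultimately show ?thesis using DERIV_divide[of \<psi>' _ x UNIV \<psi>] psi_pos[OF assms]
    by (simp add: power2_eq_square)
qed

lemma ricci_eq:
  assumes "z \<in> D" "z $ i\<^sub>0 \<noteq> 0"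
  shows "ricci g z $ \<alpha> $ \<beta> = - (of_nat (CARD('n) + 1) * H z \<alpha> \<beta>)
      - (if \<alpha> = i\<^sub>0 \<and> \<beta> = i\<^sub>0 then of_real (log_psi_laplacian ((cmod (z $ i\<^sub>0))\<^sup>2)) else 0)"
proof -
  have "(cmod (z $ i\<^sub>0))\<^sup>2 \<in> S" "N z > 0" using assms by (auto simp: in_D_iff)
  from ricci_hartogs_metric[OF open_S this _ _ psi_pos log_psi_has_derivative log_psi'_has_derivative]
  have "ricci g z $ \<alpha> $ \<beta> = - (of_nat (CARD('n) + 1) * H z \<alpha> \<beta>)
      - (if \<alpha> = i\<^sub>0 \<and> \<beta> = i\<^sub>0 then of_real (\<psi>' ((cmod (z $ i\<^sub>0))\<^sup>2) / \<psi> ((cmod (z $ i\<^sub>0))\<^sup>2)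
          + (cmod (z $ i\<^sub>0))\<^sup>2 * ((\<psi>'' ((cmod (z $ i\<^sub>0))\<^sup>2) * \<psi> ((cmod (z $ i\<^sub>0))\<^sup>2)
            - (\<psi>' ((cmod (z $ i\<^sub>0))\<^sup>2))\<^sup>2) / (\<psi> ((cmod (z $ i\<^sub>0))\<^sup>2))\<^sup>2)) else 0)"
    using F F1 by blast
  then show ?thesis by (simp only: log_psi_laplacian_def)
qed

text \<open>
  The soliton equation tested on a constant coordinate field.
\<close>

lemma soliton_diagonal:
  assumes "z \<in> D"
  shows "Re (ricci g z $ m $ m) = \<Lambda> * Re (g z $ m $ m)
    + frechet_derivative (\<lambda>w. Re (g w $ m $ m)) (at z) (X z)
    + 2 * Re (\<Sum>\<alpha>\<in>UNIV. g z $ \<alpha> $ m * dX z (axis m 1) $ \<alpha>)"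
proof -
  have herm: "g z $ \<beta> $ \<alpha> = cnj (g z $ \<alpha> $ \<beta>)" for \<alpha> \<beta>
    using kaehler assms unfolding kaehler_metric_on_def by blast
  from lie_derivative_axis[where g = g and z = z and m = m, OF herm
      holo_map_on_has_derivative(1)[OF holo assms]]
  show ?thesis
    using soliton[of "\<lambda>_. axis m 1" "\<lambda>_. axis m 1" z, OF smooth_on_const smooth_on_const assms]
    by (simp add: tensor_axis_axis)
qed

lemma has_derivative_slice_field:
  assumes "slice a \<zeta> \<in> D"
  shows "((\<lambda>\<zeta>. X (slice a \<zeta>) $ k) has_field_derivative dX (slice a \<zeta>) (axis j 1) $ k) (at \<zeta>)"
    and "((\<lambda>a. X (slice a \<zeta>) $ k) has_field_derivative dX (slice a \<zeta>) (axis i\<^sub>0 1) $ k) (at a)"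
proof -
  note X' = holo_map_on_has_derivative[OF holo assms]
  have ax: "(axis m has_derivative axis m) F" for m :: 'n and F :: "complex filter"
    using bounded_linear.has_derivative[OF bounded_linear_axis[of m] has_derivative_ident] .
  have scale: "(\<lambda>v. dX (slice a \<zeta>) (axis m v) $ k) = (*) (dX (slice a \<zeta>) (axis m 1) $ k)" for m
  proof
    fix v :: complex
    have "axis m v = v *s axis m 1" by (auto simp: vec_eq_iff axis_def)
    then show "dX (slice a \<zeta>) (axis m v) $ k = dX (slice a \<zeta>) (axis m 1) $ k * v"
      by (simp add: X'(2))
  qed
  have "((\<lambda>\<zeta>. axis i\<^sub>0 a + axis j \<zeta>) has_derivative (\<lambda>v. 0 + axis j v)) (at \<zeta>)"
    by (intro has_derivative_add has_derivative_const ax)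
  then have "(slice a has_derivative axis j) (at \<zeta>)"
    by (simp add: slice_def[abs_def])
  from bounded_linear.has_derivative[OF bounded_linear_vec_nth[of k] has_derivative_compose[OF this X'(1)]]
  show "((\<lambda>\<zeta>. X (slice a \<zeta>) $ k) has_field_derivative dX (slice a \<zeta>) (axis j 1) $ k) (at \<zeta>)"
    by (simp only: has_field_derivative_def scale)
  have "((\<lambda>a. axis i\<^sub>0 a + axis j \<zeta>) has_derivative (\<lambda>v. axis i\<^sub>0 v + 0)) (at a)"
    by (intro has_derivative_add has_derivative_const ax)
  then have "((\<lambda>a. slice a \<zeta>) has_derivative axis i\<^sub>0) (at a)"
    by (simp add: slice_def[abs_def])
  from bounded_linear.has_derivative[OF bounded_linear_vec_nth[of k] has_derivative_compose[OF this X'(1)]]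
  show "((\<lambda>a. X (slice a \<zeta>) $ k) has_field_derivative dX (slice a \<zeta>) (axis i\<^sub>0 1) $ k) (at a)"
    by (simp only: has_field_derivative_def scale)
qed

text \<open>
  The \<open>jj\<close>-component at a point \<open>(z\<^sub>0, z\<^sub>j) = (a, \<zeta>)\<close> of the slice, multiplied by \<open>m\<^sup>3\<close>,
  where \<open>m\<close> is the value of \<open>N\<close>. On the slice all coordinates except \<open>z\<^sub>0\<close> and \<open>z\<^sub>j\<close> vanish,
  so of the components \<open>g\<^sub>\<alpha>\<^sub>j\<close> only \<open>g\<^sub>j\<^sub>j = F/m\<^sup>2\<close> and \<open>g\<^sub>0\<^sub>j = - F' (cnj a) \<zeta> / m\<^sup>2\<close> are nonzero.
\<close>

lemma soliton_equation_transversal: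
  assumes z: "slice a \<zeta> \<in> D" and a: "a \<noteq> 0"
  defines "x \<equiv> (cmod a)\<^sup>2"
  defines "m \<equiv> F x - (cmod \<zeta>)\<^sup>2"
  shows "(\<Lambda> + (CARD('n) + 1)) * F x * m
    + (2 * F1 x * m - 4 * F x * F1 x) * Re (cnj a * X (slice a \<zeta>) $ i\<^sub>0)
    + 4 * F x * Re (cnj \<zeta> * X (slice a \<zeta>) $ j)
    + 2 * m * (F x * Re (dX (slice a \<zeta>) (axis j 1) $ j)
        - F1 x * Re (cnj a * (\<zeta> * dX (slice a \<zeta>) (axis j 1) $ i\<^sub>0))) = 0"
proof -
  let ?z = "slice a \<zeta>" and ?T = "D \<inter> {w. w $ i\<^sub>0 \<noteq> 0}"
  let ?P = "Re (cnj a * X ?z $ i\<^sub>0)" and ?R = "Re (cnj \<zeta> * X ?z $ j)"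
  have m: "m > 0" "N ?z = m" and x: "0 < x" "ereal x < x\<^sub>0"
    using z a by (auto simp: in_D_iff m_def x_def)
  have T: "open ?T" "?z \<in> ?T"
    using open_D z a by (auto intro!: open_Int open_Collect_neq continuous_intros)
  have gjj: "Re (g w $ j $ j) = ((cmod (w $ j))\<^sup>2 + N w) / (N w)\<^sup>2" if "w \<in> ?T" for w
  proof -
    have "cnj (w $ j) * w $ j = of_real ((cmod (w $ j))\<^sup>2)"
      by (metis complex_norm_square mult.commute)
    then have "H w j j = of_real (((cmod (w $ j))\<^sup>2 + N w) / (N w)\<^sup>2)"
      using other by (simp add: hess_log_gap_def gap_dbar_def)
    then show ?thesis using that metric_eq by simp
  qed
  have N': "(N has_derivative re_grad (gap_dbar i\<^sub>0 F1 ?z)) (at ?z)"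
    by (rule has_derivative_hartogs_gap[where ?F1.0=F1]) (use F x in \<open>simp add: x_def\<close>)
  have N'X: "re_grad (gap_dbar i\<^sub>0 F1 ?z) (X ?z) = 2 * F1 x * ?P - 2 * ?R"
    unfolding re_grad_def by (subst sum_eq_two_terms) (use other in \<open>auto simp: gap_dbar_def x_def algebra_simps\<close>)
  have jX: "re_grad (\<lambda>k. if k = j then \<zeta> else 0) (X ?z) = 2 * ?R"
    unfolding re_grad_def by (subst sum_eq_two_terms) (use other in auto)
  have "((\<lambda>w. ((cmod (w $ j))\<^sup>2 + N w) / (N w)\<^sup>2) has_derivative
      (\<lambda>v. ((re_grad (\<lambda>k. if k = j then ?z $ j else 0) v + re_grad (gap_dbar i\<^sub>0 F1 ?z) v) * (N ?z)\<^sup>2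
         - ((cmod (?z $ j))\<^sup>2 + N ?z) * (of_nat 2 * re_grad (gap_dbar i\<^sub>0 F1 ?z) v * N ?z ^ (2 - 1)))
        / ((N ?z)\<^sup>2 * (N ?z)\<^sup>2))) (at ?z)"
    by (intro has_derivative_divide' has_derivative_add has_derivative_power
        has_derivative_cmod_square_nth N') (use m in simp)
  note deriv = frechet_derivative_at[OF this, symmetric]
  have cong: "frechet_derivative (\<lambda>w. Re (g w $ j $ j)) (at ?z)
      = frechet_derivative (\<lambda>w. ((cmod (w $ j))\<^sup>2 + N w) / (N w)\<^sup>2) (at ?z)"
    by (rule frechet_derivative_cong_open[OF T]) (rule gjj)
  have "frechet_derivative (\<lambda>w. Re (g w $ j $ j)) (at ?z) (X ?z)
      = ((2 * ?R + (2 * F1 x * ?P - 2 * ?R)) * m\<^sup>2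
        - ((cmod \<zeta>)\<^sup>2 + m) * (of_nat 2 * (2 * F1 x * ?P - 2 * ?R) * m ^ (2 - 1))) / (m\<^sup>2 * m\<^sup>2)"
    by (simp only: cong deriv N'X jX m(2) slice_nth)
  then have D_g: "frechet_derivative (\<lambda>w. Re (g w $ j $ j)) (at ?z) (X ?z)
      = ((2 * F1 x * ?P) * m\<^sup>2 - F x * (2 * (2 * F1 x * ?P - 2 * ?R) * m)) / (m\<^sup>2 * m\<^sup>2)"
    by (simp add: m_def)
  have ric_jj: "ricci g ?z $ j $ j = - (of_nat (CARD('n) + 1) * of_real (F x / m\<^sup>2))"
    and g_jj: "g ?z $ j $ j = of_real (F x / m\<^sup>2)"
    and g_0j: "g ?z $ i\<^sub>0 $ j = - (of_real (F1 x / m\<^sup>2) * (cnj a * \<zeta>))"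
    and g_others: "\<And>\<alpha>. \<alpha> \<noteq> i\<^sub>0 \<Longrightarrow> \<alpha> \<noteq> j \<Longrightarrow> g ?z $ \<alpha> $ j = 0"
  proof -
    have "cnj \<zeta> * \<zeta> = of_real ((cmod \<zeta>)\<^sup>2)"
      by (metis complex_norm_square mult.commute)
    then have Hjj: "H ?z j j = of_real (F x / m\<^sup>2)"
      using other by (simp add: hess_log_gap_def gap_dbar_def m_def flip: x_def)
    then show "ricci g ?z $ j $ j = - (of_nat (CARD('n) + 1) * of_real (F x / m\<^sup>2))"
      and "g ?z $ j $ j = of_real (F x / m\<^sup>2)"
      using ricci_eq[OF z] metric_eq[OF z] other a by auto
    show "g ?z $ i\<^sub>0 $ j = - (of_real (F1 x / m\<^sup>2) * (cnj a * \<zeta>))"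
      using metric_eq[OF z] a other by (simp add: hess_log_gap_def gap_dbar_def m_def flip: x_def)
    show "g ?z $ \<alpha> $ j = 0" if "\<alpha> \<noteq> i\<^sub>0" "\<alpha> \<noteq> j" for \<alpha>
      using metric_eq[OF z] a that by (simp add: hess_log_gap_def gap_dbar_def)
  qed
  have "(\<Sum>\<alpha>\<in>UNIV. g ?z $ \<alpha> $ j * dX ?z (axis j 1) $ \<alpha>)
      = g ?z $ i\<^sub>0 $ j * dX ?z (axis j 1) $ i\<^sub>0 + g ?z $ j $ j * dX ?z (axis j 1) $ j"
    by (intro sum_eq_two_terms) (simp add: g_others)
  also have "\<dots> = of_real (F x / m\<^sup>2) * dX ?z (axis j 1) $ j
      - of_real (F1 x / m\<^sup>2) * (cnj a * (\<zeta> * dX ?z (axis j 1) $ i\<^sub>0))"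
    by (simp only: g_jj g_0j) (simp add: algebra_simps)
  finally have Re_sum: "Re (\<Sum>\<alpha>\<in>UNIV. g ?z $ \<alpha> $ j * dX ?z (axis j 1) $ \<alpha>)
      = F x / m\<^sup>2 * Re (dX ?z (axis j 1) $ j)
        - F1 x / m\<^sup>2 * Re (cnj a * (\<zeta> * dX ?z (axis j 1) $ i\<^sub>0))"
    by (simp only: minus_complex.sel Re_complex_of_real times_complex.sel Im_complex_of_real mult_zero_left diff_0_right)
  have Re_ric: "Re (ricci g ?z $ j $ j) = - (real (CARD('n) + 1) * (F x / m\<^sup>2))"
    by (simp add: ric_jj)
  have Re_g: "Re (g ?z $ j $ j) = F x / m\<^sup>2"
    by (simp only: g_jj Re_complex_of_real)
  have "- (real (CARD('n) + 1) * (F x / m\<^sup>2)) = \<Lambda> * (F x / m\<^sup>2)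
      + ((2 * F1 x * ?P) * m\<^sup>2 - F x * (2 * (2 * F1 x * ?P - 2 * ?R) * m)) / (m\<^sup>2 * m\<^sup>2)
      + 2 * (F x / m\<^sup>2 * Re (dX ?z (axis j 1) $ j)
        - F1 x / m\<^sup>2 * Re (cnj a * (\<zeta> * dX ?z (axis j 1) $ i\<^sub>0)))"
    using soliton_diagonal[OF z, of j] by (simp only: Re_ric Re_g Re_sum D_g)
  moreover have "(L + c) * f * m + (2 * f1 * m - 4 * f * f1) * P + 4 * f * R + 2 * m * (f * A - f1 * B)
      = m^3 * (L * (f / m\<^sup>2)
          + ((2 * f1 * P) * m\<^sup>2 - f * (2 * (2 * f1 * P - 2 * R) * m)) / (m\<^sup>2 * m\<^sup>2)
          + 2 * (f / m\<^sup>2 * A - f1 / m\<^sup>2 * B) - - (c * (f / m\<^sup>2)))" for L c f f1 P R A B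
    using m(1) by (simp add: field_simps eval_nat_numeral)
  ultimately show ?thesis by (simp only: of_nat_add of_nat_1) simp
qed

section \<open>Averaging the soliton equation\<close>

lemma holomorphic_slice:
  assumes "ereal ((cmod a)\<^sup>2) < x\<^sub>0"
  defines "U \<equiv> ball 0 (sqrt (F ((cmod a)\<^sup>2)))"
  shows "(\<lambda>\<zeta>. X (slice a \<zeta>) $ k) holomorphic_on U"
    and "(\<lambda>\<zeta>. dX (slice a \<zeta>) (axis j 1) $ k) holomorphic_on U"
proof -
  have F: "F ((cmod a)\<^sup>2) > 0" using F_pos assms by simp
  have in_D: "slice a \<zeta> \<in> D" if "\<zeta> \<in> U" for \<zeta>
  proof -
    have "(cmod \<zeta>)\<^sup>2 < (sqrt (F ((cmod a)\<^sup>2)))\<^sup>2"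
      using that by (intro power_strict_mono) (auto simp: U_def)
    then show ?thesis using F assms by (simp add: slice_in_D_iff)
  qed
  have U: "open U" by (simp add: U_def)
  show holo: "(\<lambda>\<zeta>. X (slice a \<zeta>) $ k) holomorphic_on U"
    unfolding holomorphic_on_open[OF U] using has_derivative_slice_field(1)[OF in_D] by blast
  show "(\<lambda>\<zeta>. dX (slice a \<zeta>) (axis j 1) $ k) holomorphic_on U"
    by (rule holomorphic_transform[OF holomorphic_deriv[OF holo U]])
      (simp add: DERIV_imp_deriv[OF has_derivative_slice_field(1)[OF in_D]])
qed

text \<open>
  The mean of \<open>soliton_equation_transversal\<close> over \<open>|\<zeta>| = \<rho>\<close>. In every term only the value
  or the linear coefficient at \<open>\<zeta> = 0\<close> survives; the term with \<open>g\<^sub>0\<^sub>j\<close> has mean zero because of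
  its factor \<open>\<zeta>\<close>.
\<close>

lemma slice_mean_identity:
  fixes a :: complex
  defines "x \<equiv> (cmod a)\<^sup>2"
  assumes a: "a \<noteq> 0" "ereal x < x\<^sub>0" and \<rho>: "0 < \<rho>" "\<rho>\<^sup>2 < F x"
  shows "(\<Lambda> + (CARD('n) + 1)) * F x * (F x - \<rho>\<^sup>2)
    + (2 * F1 x * (F x - \<rho>\<^sup>2) - 4 * F x * F1 x) * Re (cnj a * X (slice a 0) $ i\<^sub>0)
    + 4 * F x * (\<rho>\<^sup>2 * Re (dX (slice a 0) (axis j 1) $ j))
    + 2 * (F x - \<rho>\<^sup>2) * (F x * Re (dX (slice a 0) (axis j 1) $ j)) = 0"
proof -
  let ?c = "circlepath 0 \<rho>"
  let ?h = "\<lambda>k \<zeta>. X (slice a \<zeta>) $ k" and ?h' = "\<lambda>k \<zeta>. dX (slice a \<zeta>) (axis j 1) $ k"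
  let ?U = "ball 0 (sqrt (F x)) :: complex set"
  have in_D: "slice a \<zeta> \<in> D" if "cmod \<zeta> \<le> \<rho>" for \<zeta>
  proof -
    have "(cmod \<zeta>)\<^sup>2 \<le> \<rho>\<^sup>2" by (rule power_mono[OF that norm_ge_zero])
    then have "(cmod \<zeta>)\<^sup>2 < F x" using \<rho>(2) by linarith
    then show ?thesis using a by (simp add: slice_in_D_iff x_def)
  qed
  have "\<rho> < sqrt (F x)" using \<rho> by (simp add: real_less_rsqrt)
  then have sub: "cball 0 \<rho> \<subseteq> ?U" by auto
  have h: "?h k holomorphic_on cball 0 \<rho>" and h': "?h' k holomorphic_on cball 0 \<rho>" for k
    using holomorphic_slice[of a k] a by (auto simp flip: x_def intro: holomorphic_on_subset[OF _ sub])
  have deriv_h: "deriv (?h j) 0 = ?h' j 0"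
    by (rule DERIV_imp_deriv[OF has_derivative_slice_field(1)[OF in_D]]) (use \<rho> in simp)
  have P: "((\<lambda>t. Re (cnj a * ?h i\<^sub>0 (?c t))) has_integral Re (cnj a * ?h i\<^sub>0 0)) {0..1}"
    by (intro has_integral_Re has_integral_mult_right circle_mean h \<rho>)
  have R: "((\<lambda>t. Re (cnj (?c t) * ?h j (?c t))) has_integral \<rho>\<^sup>2 * Re (?h' j 0)) {0..1}"
    using has_integral_Re[OF circle_mean_cnj_times[OF \<rho>(1) h[of j]]] by (simp add: deriv_h)
  have Q: "((\<lambda>t. Re (?h' j (?c t))) has_integral Re (?h' j 0)) {0..1}"
    by (intro has_integral_Re circle_mean h' \<rho>)
  have Z: "((\<lambda>t. Re (cnj a * (?c t * ?h' i\<^sub>0 (?c t)))) has_integral Re (cnj a * (0 * ?h' i\<^sub>0 0))) {0..1}"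
    by (intro has_integral_Re has_integral_mult_right circle_mean[where f = "\<lambda>\<zeta>. \<zeta> * ?h' i\<^sub>0 \<zeta>"]
        holomorphic_on_mult holomorphic_on_ident h' \<rho>)
  let ?C = "(\<Lambda> + (CARD('n) + 1)) * F x * (F x - \<rho>\<^sup>2)"
  have C: "((\<lambda>_. ?C) has_integral ?C) {0..1::real}"
    using has_integral_const_real[of ?C 0 1] by simp
  have "((\<lambda>t. ?C + (2 * F1 x * (F x - \<rho>\<^sup>2) - 4 * F x * F1 x) * Re (cnj a * ?h i\<^sub>0 (?c t))
      + 4 * F x * Re (cnj (?c t) * ?h j (?c t))
      + 2 * (F x - \<rho>\<^sup>2) * (F x * Re (?h' j (?c t)) - F1 x * Re (cnj a * (?c t * ?h' i\<^sub>0 (?c t)))))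
    has_integral ?C + (2 * F1 x * (F x - \<rho>\<^sup>2) - 4 * F x * F1 x) * Re (cnj a * ?h i\<^sub>0 0)
      + 4 * F x * (\<rho>\<^sup>2 * Re (?h' j 0))
      + 2 * (F x - \<rho>\<^sup>2) * (F x * Re (?h' j 0) - F1 x * Re (cnj a * (0 * ?h' i\<^sub>0 0)))) {0..1}"
    by (intro has_integral_add has_integral_diff has_integral_mult_right C P Q R Z)
  moreover have "?C + (2 * F1 x * (F x - \<rho>\<^sup>2) - 4 * F x * F1 x) * Re (cnj a * ?h i\<^sub>0 (?c t))
      + 4 * F x * Re (cnj (?c t) * ?h j (?c t))
      + 2 * (F x - \<rho>\<^sup>2) * (F x * Re (?h' j (?c t)) - F1 x * Re (cnj a * (?c t * ?h' i\<^sub>0 (?c t)))) = 0" for t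
    using soliton_equation_transversal[OF in_D a(1), of "?c t"] \<rho>(1) by (simp only: norm_circlepath_0 x_def less_imp_le)
  ultimately have "((\<lambda>_. 0) has_integral ?C + (2 * F1 x * (F x - \<rho>\<^sup>2) - 4 * F x * F1 x) * Re (cnj a * ?h i\<^sub>0 0)
      + 4 * F x * (\<rho>\<^sup>2 * Re (?h' j 0))
      + 2 * (F x - \<rho>\<^sup>2) * (F x * Re (?h' j 0) - F1 x * Re (cnj a * (0 * ?h' i\<^sub>0 0)))) {0..1::real}"
    by (simp only:)
  from has_integral_unique[OF this has_integral_0] show ?thesis by simp
qed

text \<open>
  With \<open>s = \<rho>\<^sup>2\<close> the averaged equation reads
  \<open>\<mu> F (F - s) - 2 (F + s) (P - Q) = 0\<close> for all \<open>0 < s < F\<close>, where \<open>\<mu> = \<Lambda> + n + 1\<close>. The two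
  functions \<open>F - s\<close> and \<open>F + s\<close> of \<open>s\<close> are linearly independent, so both coefficients vanish.
\<close>

lemma soliton_constant_and_slice_relation:
  fixes a :: complex
  defines "x \<equiv> (cmod a)\<^sup>2"
  assumes a: "a \<noteq> 0" "ereal x < x\<^sub>0"
  shows "\<Lambda> + (CARD('n) + 1) = 0"
    and "F x * Re (dX (slice a 0) (axis j 1) $ j) = F1 x * Re (cnj a * X (slice a 0) $ i\<^sub>0)"
proof -
  let ?\<mu> = "\<Lambda> + (CARD('n) + 1)"
  define P where "P = F1 x * Re (cnj a * X (slice a 0) $ i\<^sub>0)"
  define Q where "Q = F x * Re (dX (slice a 0) (axis j 1) $ j)"
  have Fx: "F x > 0" using F_pos a by (simp add: x_def)
  define M where "M = ?\<mu> * F x"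
  have eq: "M * (F x - s) - 2 * (F x + s) * P + 2 * (F x + s) * Q = 0" if "0 < s" "s < F x" for s
    using slice_mean_identity[of a "sqrt s"] a that
    by (simp add: x_def[symmetric] P_def Q_def M_def algebra_simps)
  \<comment> \<open>Two values of \<open>s\<close> suffice, as the equation is affine in \<open>s\<close>.\<close>
  have "F x * (3 * M - 10 * P + 10 * Q) = 0"
    using eq[of "F x / 4"] Fx by (simp add: algebra_simps)
  moreover have "F x * (M - 6 * P + 6 * Q) = 0"
    using eq[of "F x / 2"] Fx by (simp add: algebra_simps)
  ultimately have "3 * M - 10 * P + 10 * Q = 0" "M - 6 * P + 6 * Q = 0"
    using Fx by simp_all
  then have "?\<mu> * F x = 0" "Q = P" unfolding M_def[symmetric] by linarith+
  then show "?\<mu> = 0" "F x * Re (dX (slice a 0) (axis j 1) $ j) = F1 x * Re (cnj a * X (slice a 0) $ i\<^sub>0)"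
    using Fx by (auto simp: P_def Q_def)
qed

text \<open>
  The component \<open>f\<^sub>0\<close> of \<open>X\<close> along \<open>z' = 0\<close>, as a function of \<open>z\<^sub>0\<close>.
\<close>

definition p where "p a = X (slice a 0) $ i\<^sub>0"

definition p' where "p' a = dX (slice a 0) (axis i\<^sub>0 1) $ i\<^sub>0"

lemma open_base: "open {a::complex. ereal ((cmod a)\<^sup>2) < x\<^sub>0}"
proof -
  have "open ((\<lambda>a::complex. (cmod a)\<^sup>2) -` {x. ereal x < x\<^sub>0})"
    by (rule open_vimage[OF open_ereal_less]) (intro continuous_intros)
  then show ?thesis by (simp add: vimage_def)
qed

lemma p_deriv:
  assumes "ereal ((cmod a)\<^sup>2) < x\<^sub>0"
  shows "(p has_field_derivative p' a) (at a)"
  unfolding p_def[abs_def] p'_def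
  by (rule has_derivative_slice_field(2)) (use assms F_pos in \<open>simp add: slice_in_D_iff\<close>)

lemma holomorphic_p:
  "p holomorphic_on {a. ereal ((cmod a)\<^sup>2) < x\<^sub>0}" "p' holomorphic_on {a. ereal ((cmod a)\<^sup>2) < x\<^sub>0}"
proof -
  show holo: "p holomorphic_on {a. ereal ((cmod a)\<^sup>2) < x\<^sub>0}"
    unfolding holomorphic_on_open[OF open_base] using p_deriv by blast
  show "p' holomorphic_on {a. ereal ((cmod a)\<^sup>2) < x\<^sub>0}"
    by (rule holomorphic_transform[OF holomorphic_deriv[OF holo open_base]])
      (simp add: DERIV_imp_deriv[OF p_deriv])
qed

lemma base_le:
  assumes "ereal (r\<^sup>2) < x\<^sub>0" "cmod a \<le> r" shows "ereal ((cmod a)\<^sup>2) < x\<^sub>0"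
  using power_mono[OF assms(2) norm_ge_zero, of 2] assms(1)
  by (simp add: order.strict_trans1[of "ereal ((cmod a)\<^sup>2)" "ereal (r\<^sup>2)"])

lemma mean_p:
  assumes "0 < r" "ereal (r\<^sup>2) < x\<^sub>0"
  shows "((\<lambda>t. Re (cnj (circlepath 0 r t) * p (circlepath 0 r t))) has_integral r\<^sup>2 * Re (p' 0)) {0..1}"
    and "((\<lambda>t. Re (p' (circlepath 0 r t))) has_integral Re (p' 0)) {0..1}"
proof -
  have sub: "cball 0 r \<subseteq> {a. ereal ((cmod a)\<^sup>2) < x\<^sub>0}"
    using base_le[OF assms(2)] by auto
  have "deriv p 0 = p' 0"
    by (rule DERIV_imp_deriv[OF p_deriv]) (use x0_pos in \<open>simp add: zero_ereal_def\<close>)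
  then show "((\<lambda>t. Re (cnj (circlepath 0 r t) * p (circlepath 0 r t))) has_integral r\<^sup>2 * Re (p' 0)) {0..1}"
    using has_integral_Re[OF circle_mean_cnj_times[OF assms(1) holomorphic_on_subset[OF holomorphic_p(1) sub]]]
    by simp
  show "((\<lambda>t. Re (p' (circlepath 0 r t))) has_integral Re (p' 0)) {0..1}"
    by (intro has_integral_Re circle_mean holomorphic_on_subset[OF holomorphic_p(2) sub] assms)
qed

text \<open>
  The relation \<open>F Q = F' P\<close> of \<open>soliton_constant_and_slice_relation\<close>, averaged over
  \<open>|a| = r\<close>. The mean of \<open>q(a) = \<partial>\<^sub>jX\<^sub>j(a, 0)\<close> is \<open>q(0)\<close>: to see this without proving that
  the partial derivative \<open>q\<close> is again holomorphic in \<open>a\<close>, it is written as a circle mean of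
  \<open>X\<^sub>j(a, \<zeta>) / \<zeta>\<close> over \<open>\<zeta>\<close>, and the two circle means are interchanged.
\<close>

lemma transversal_divergence_mean:
  assumes r: "0 < r" "ereal (r\<^sup>2) < x\<^sub>0"
  shows "Re (dX (slice 0 0) (axis j 1) $ j) = r\<^sup>2 * F1 (r\<^sup>2) / F (r\<^sup>2) * Re (p' 0)"
proof -
  define q where "q a = dX (slice a 0) (axis j 1) $ j" for a
  \<comment> \<open>\<open>F\<close> decreases, so the bidisc of radii \<open>r\<close> and \<open>\<rho>\<close> lies in \<open>D\<close> if \<open>\<rho>\<^sup>2 < F(r\<^sup>2)\<close>.\<close>
  define \<rho> where "\<rho> = sqrt (F (r\<^sup>2)) / 2"
  have Fr: "F (r\<^sup>2) > 0" using F_pos r by simp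
  have \<rho>: "0 < \<rho>" "\<rho>\<^sup>2 < F (r\<^sup>2)" using Fr by (simp_all add: \<rho>_def power_divide)
  have in_D: "slice a \<zeta> \<in> D" if "cmod a \<le> r" "cmod \<zeta> \<le> \<rho>" for a \<zeta>
  proof -
    have "F (r\<^sup>2) \<le> F ((cmod a)\<^sup>2)"
      using power_mono[OF that(1) norm_ge_zero, of 2] r(2) by (intro F_antimono) auto
    then show ?thesis
      using power_mono[OF that(2) norm_ge_zero, of 2] base_le[OF r(2) that(1)] \<rho>(2)
      by (simp add: slice_in_D_iff)
  qed
  let ?c = "circlepath 0 r" and ?d = "circlepath 0 \<rho>"
  let ?f = "\<lambda>t s. Re (X (slice (?c t) (?d s)) $ j / ?d s)"
  have inner: "((\<lambda>s. Re (X (slice a (?d s)) $ j / ?d s)) has_integral Re (q a)) {0..1}"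
    if "cmod a \<le> r" for a
  proof -
    have "(\<lambda>\<zeta>. X (slice a \<zeta>) $ j) holomorphic_on cball 0 \<rho>"
      by (rule holomorphic_on_if_has_derivative[OF has_derivative_slice_field(1)[OF in_D[OF that]]]) simp
    then have "((\<lambda>s. X (slice a (?d s)) $ j / ?d s ^ 1) has_integral
        (deriv ^^ 1) (\<lambda>\<zeta>. X (slice a \<zeta>) $ j) 0 / fact 1) {0..1}"
      by (intro circle_mean_divide_power \<rho>)
        (auto intro: holomorphic_on_imp_continuous_on holomorphic_on_subset)
    moreover have "deriv (\<lambda>\<zeta>. X (slice a \<zeta>) $ j) 0 = q a"
      unfolding q_def by (rule DERIV_imp_deriv[OF has_derivative_slice_field(1)[OF in_D[OF that]]])
        (use \<rho> in simp)
    ultimately have "((\<lambda>s. X (slice a (?d s)) $ j / ?d s) has_integral q a) {0..1}" by simp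
    then show ?thesis by (rule has_integral_Re)
  qed
  have outer: "((\<lambda>t. ?f t s) has_integral Re (X (slice 0 (?d s)) $ j / ?d s)) {0..1}" for s
  proof -
    have "(\<lambda>a. X (slice a (?d s)) $ j) holomorphic_on cball 0 r"
      by (rule holomorphic_on_if_has_derivative[OF has_derivative_slice_field(2)[OF in_D]])
        (use \<rho>(1) in simp_all)
    from circle_mean[OF r(1) this]
    show ?thesis by (intro has_integral_Re has_integral_divide)
  qed
  have cont: "continuous_on (cbox (0,0) (1,1)) (\<lambda>(t, s). ?f t s)"
  proof -
    have "continuous_on D X"
      using has_derivative_continuous[OF holo_map_on_has_derivative(1)[OF holo]]
      by (intro continuous_at_imp_continuous_on) blast
    moreover have "continuous_on (cbox (0,0) (1,1)) (\<lambda>u::real\<times>real. slice (?c (fst u)) (?d (snd u)))"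
      unfolding slice_def circlepath
      by (intro continuous_intros bounded_linear.continuous_on[OF bounded_linear_axis])
    ultimately have "continuous_on (cbox (0,0) (1,1)) (\<lambda>u::real\<times>real. X (slice (?c (fst u)) (?d (snd u))))"
      by (rule continuous_on_compose2) (use in_D r \<rho> in auto)
    moreover have "continuous_on (cbox (0,0) (1,1)) (\<lambda>u::real\<times>real. ?d (snd u))"
      unfolding circlepath by (intro continuous_intros)
    moreover have "?d s \<noteq> 0" for s using \<rho> by (simp add: circlepath)
    ultimately show ?thesis
      unfolding case_prod_unfold by (intro continuous_intros) auto
  qed
  have "integral {0..1} (\<lambda>t. integral {0..1} (?f t)) = integral {0..1} (\<lambda>s. integral {0..1} (\<lambda>t. ?f t s))"
    using integral_swap_continuous[of 0 0 1 1 ?f] cont by simp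
  also have "(\<lambda>s. integral {0..1} (\<lambda>t. ?f t s)) = (\<lambda>s. Re (X (slice 0 (?d s)) $ j / ?d s))"
    by (intro ext integral_unique outer)
  also have "integral {0..1} (\<lambda>s. Re (X (slice 0 (?d s)) $ j / ?d s)) = Re (q 0)"
    by (rule integral_unique[OF inner]) (use r in simp)
  also have "(\<lambda>t. integral {0..1} (?f t)) = (\<lambda>t. F1 (r\<^sup>2) / F (r\<^sup>2) * Re (cnj (?c t) * p (?c t)))"
  proof
    fix t
    have "integral {0..1} (?f t) = Re (q (?c t))"
      by (rule integral_unique[OF inner]) (use r in simp)
    also have "?c t \<noteq> 0" using r by (simp add: circlepath)
    then have "F (r\<^sup>2) * Re (q (?c t)) = F1 (r\<^sup>2) * Re (cnj (?c t) * p (?c t))"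
      using soliton_constant_and_slice_relation(2)[of "?c t"] r by (simp add: q_def p_def)
    then have "Re (q (?c t)) = F1 (r\<^sup>2) / F (r\<^sup>2) * Re (cnj (?c t) * p (?c t))"
      using Fr by (simp add: field_simps)
    finally show "integral {0..1} (?f t) = F1 (r\<^sup>2) / F (r\<^sup>2) * Re (cnj (?c t) * p (?c t))" .
  qed
  also have "integral {0..1} (\<lambda>t. F1 (r\<^sup>2) / F (r\<^sup>2) * Re (cnj (?c t) * p (?c t)))
      = F1 (r\<^sup>2) / F (r\<^sup>2) * (r\<^sup>2 * Re (p' 0))"
    by (intro integral_unique has_integral_mult_right mean_p r)
  finally show ?thesis by (simp add: q_def mult_ac)
qed

definition W :: "real \<Rightarrow> real" where "W x = x * F1 x / F x"

lemma W_has_derivative: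
  assumes "x \<in> S" shows "(W has_real_derivative - \<psi> x / (F x)\<^sup>2) (at x)"
proof -
  have "F x \<noteq> 0" using F_pos[of x] assms by auto
  then show ?thesis unfolding W_def[abs_def] hartogs_psi_def
    using assms by (auto intro!: derivative_eq_intros F F1) (simp add: field_simps power2_eq_square)
qed

lemma S_nonempty: "S \<noteq> {}"
  using ereal_dense2[OF x0_pos] by (auto simp: zero_ereal_def)

text \<open>
  By \<open>transversal_divergence_mean\<close> the product of \<open>Re (p' 0)\<close> with the function \<open>W\<close> is
  constant, while \<open>W' = - \<psi>/F\<^sup>2\<close> has no zero.
\<close>

lemma radial_divergence_zero: "Re (p' 0) = 0"
proof -
  obtain x where x: "x \<in> S" using S_nonempty by blast
  let ?B = "Re (dX (slice 0 0) (axis j 1) $ j)"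
  have "?B = W y * Re (p' 0)" if "y \<in> S" for y
    using transversal_divergence_mean[of "sqrt y"] that by (simp add: W_def)
  then have "((\<lambda>y. W y * Re (p' 0)) has_real_derivative 0) (at x)"
    using has_field_derivative_transform_within_open[OF DERIV_const open_S x, of ?B] by simp
  moreover have "((\<lambda>y. W y * Re (p' 0)) has_real_derivative - \<psi> x / (F x)\<^sup>2 * Re (p' 0)) (at x)"
    by (rule DERIV_cmult_right[OF W_has_derivative[OF x]])
  ultimately have "- \<psi> x / (F x)\<^sup>2 * Re (p' 0) = 0"
    by (rule DERIV_unique[symmetric])
  then show ?thesis using psi_pos[OF x] F_pos[of x] x by auto
qed

text \<open>
  The \<open>00\<close>-component at points with \<open>z' = 0\<close>. There \<open>g\<^sub>\<alpha>\<^sub>0 = 0\<close> for \<open>\<alpha> \<noteq> 0\<close>, and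
  \<open>g\<^sub>0\<^sub>0\<close> depends to first order on \<open>|z\<^sub>0|\<close> only, so its derivative along \<open>X\<close> is
  \<open>2 Re (cnj a * p a)\<close> times a factor that is constant on the circles \<open>|a| = r\<close>.
\<close>

lemma soliton_equation_base:
  fixes a :: complex
  defines "x \<equiv> (cmod a)\<^sup>2"
  defines "\<kappa> \<equiv> \<psi> x / (F x)\<^sup>2"
  assumes a: "a \<noteq> 0" "ereal x < x\<^sub>0"
  shows "- (real (CARD('n) + 1) * \<kappa>) - log_psi_laplacian x = \<Lambda> * \<kappa>
    + (((F1 x)\<^sup>2 + 2 * x * F1 x * F2 x - (F x * (2 * F2 x + x * F3 x) + F1 x * (F1 x + x * F2 x))) * (F x)\<^sup>2
         - \<psi> x * (2 * F1 x * F x)) / ((F x)\<^sup>2 * (F x)\<^sup>2) * (2 * Re (cnj a * p a))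
    + 2 * (\<kappa> * Re (p' a))"
proof -
  let ?z = "slice a 0" and ?T = "D \<inter> {w. w $ i\<^sub>0 \<noteq> 0}"
  let ?\<tau> = "2 * Re (cnj a * p a)"
  let ?r = "\<lambda>w::complex^'n. (cmod (w $ i\<^sub>0))\<^sup>2"
  define u where "u y = y * (F1 y)\<^sup>2" for y
  define v where "v y = F1 y + y * F2 y" for y
  define u' where "u' = (F1 x)\<^sup>2 + 2 * x * F1 x * F2 x"
  define v' where "v' = 2 * F2 x + x * F3 x"
  have x: "0 < x" and Fx: "F x > 0" using F_pos a by (auto simp: x_def)
  have z: "?z \<in> D" using a Fx by (simp add: slice_in_D_iff x_def)
  have Nz: "N ?z = F x" by (simp add: x_def)
  have T: "open ?T" "?z \<in> ?T"
    using open_D z a by (auto intro!: open_Int open_Collect_neq continuous_intros)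
  have H00: "H w i\<^sub>0 i\<^sub>0 = of_real ((u (?r w) - N w * v (?r w)) / (N w)\<^sup>2)" for w
  proof -
    have "cnj (w $ i\<^sub>0) * w $ i\<^sub>0 = of_real (?r w)"
      by (metis complex_norm_square mult.commute)
    moreover have "cnj (gap_dbar i\<^sub>0 F1 w i\<^sub>0) * gap_dbar i\<^sub>0 F1 w i\<^sub>0
        = (of_real (F1 (?r w)))\<^sup>2 * (cnj (w $ i\<^sub>0) * w $ i\<^sub>0)"
      by (simp add: gap_dbar_def) (simp add: power2_eq_square)
    ultimately show ?thesis
      by (simp add: hess_log_gap_def u_def v_def mult_ac)
  qed
  have \<kappa>: "(u x - F x * v x) = \<psi> x" by (simp add: u_def v_def hartogs_psi_def)
  have g00: "g w $ i\<^sub>0 $ i\<^sub>0 = of_real ((u (?r w) - N w * v (?r w)) / (N w)\<^sup>2)" if "w \<in> ?T" for w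
    using that metric_eq H00 by simp
  have u: "(u has_real_derivative u') (at (?r ?z))"
    unfolding u_def u'_def using x a
    by (auto intro!: derivative_eq_intros F1 simp flip: x_def)
  have v: "(v has_real_derivative v') (at (?r ?z))"
    unfolding v_def v'_def using x a
    by (auto intro!: derivative_eq_intros F1 F2 simp flip: x_def)
  have N': "(N has_derivative re_grad (gap_dbar i\<^sub>0 F1 ?z)) (at ?z)"
    by (rule has_derivative_hartogs_gap[where ?F1.0=F1]) (use F x a in \<open>simp add: x_def\<close>)
  have N'X: "re_grad (gap_dbar i\<^sub>0 F1 ?z) (X ?z) = F1 x * ?\<tau>"
    unfolding re_grad_def by (subst sum_eq_two_terms) (use other in \<open>auto simp: gap_dbar_def x_def p_def algebra_simps\<close>)
  have rX: "re_grad (\<lambda>k. if k = i\<^sub>0 then of_real c * a else 0) (X ?z) = c * ?\<tau>" for c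
    unfolding re_grad_def by (subst sum_eq_two_terms) (use other in \<open>auto simp: p_def algebra_simps\<close>)
  have "((\<lambda>w. (u (?r w) - N w * v (?r w)) / (N w)\<^sup>2) has_derivative
      (\<lambda>y. ((re_grad (\<lambda>k. if k = i\<^sub>0 then of_real u' * ?z $ i\<^sub>0 else 0) y
          - (N ?z * re_grad (\<lambda>k. if k = i\<^sub>0 then of_real v' * ?z $ i\<^sub>0 else 0) y
            + re_grad (gap_dbar i\<^sub>0 F1 ?z) y * v (?r ?z))) * (N ?z)\<^sup>2
         - (u (?r ?z) - N ?z * v (?r ?z)) * (of_nat 2 * re_grad (gap_dbar i\<^sub>0 F1 ?z) y * N ?z ^ (2 - 1)))
        / ((N ?z)\<^sup>2 * (N ?z)\<^sup>2))) (at ?z)"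
    by (intro has_derivative_divide' has_derivative_diff has_derivative_mult has_derivative_power
        has_derivative_radial u v N') (use Nz Fx in simp)
  note deriv = frechet_derivative_at[OF this, symmetric]
  have cong: "frechet_derivative (\<lambda>w. Re (g w $ i\<^sub>0 $ i\<^sub>0)) (at ?z)
      = frechet_derivative (\<lambda>w. (u (?r w) - N w * v (?r w)) / (N w)\<^sup>2) (at ?z)"
    by (rule frechet_derivative_cong_open[OF T]) (simp only: g00 Re_complex_of_real)
  have "frechet_derivative (\<lambda>w. Re (g w $ i\<^sub>0 $ i\<^sub>0)) (at ?z) (X ?z)
      = ((u' * ?\<tau> - (F x * (v' * ?\<tau>) + (F1 x * ?\<tau>) * v x)) * (F x)\<^sup>2
        - \<psi> x * (of_nat 2 * (F1 x * ?\<tau>) * F x ^ (2 - 1))) / ((F x)\<^sup>2 * (F x)\<^sup>2)"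
    by (simp only: cong deriv N'X rX Nz \<kappa> slice_nth(1) flip: x_def)
  then have D_g: "frechet_derivative (\<lambda>w. Re (g w $ i\<^sub>0 $ i\<^sub>0)) (at ?z) (X ?z)
      = ((u' - (F x * v' + F1 x * v x)) * (F x)\<^sup>2 - \<psi> x * (2 * F1 x * F x)) / ((F x)\<^sup>2 * (F x)\<^sup>2) * ?\<tau>"
    by (simp add: algebra_simps)
  have g_z: "g ?z $ i\<^sub>0 $ i\<^sub>0 = of_real \<kappa>"
    using g00[OF T(2)] by (simp only: Nz slice_nth(1) \<kappa> \<kappa>_def flip: x_def)
  have H_z: "H ?z i\<^sub>0 i\<^sub>0 = of_real \<kappa>"
    using g_z metric_eq[OF z] a by simp
  have "g ?z $ \<alpha> $ i\<^sub>0 = 0" if "\<alpha> \<noteq> i\<^sub>0" for \<alpha>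
    using metric_eq[OF z] a that by (cases "\<alpha> = j") (simp_all add: hess_log_gap_def gap_dbar_def)
  then have "(\<Sum>\<alpha>\<in>UNIV. g ?z $ \<alpha> $ i\<^sub>0 * dX ?z (axis i\<^sub>0 1) $ \<alpha>) = of_real \<kappa> * p' a"
    using other by (subst sum_eq_two_terms) (simp_all add: g_z p'_def)
  then have Re_sum: "Re (\<Sum>\<alpha>\<in>UNIV. g ?z $ \<alpha> $ i\<^sub>0 * dX ?z (axis i\<^sub>0 1) $ \<alpha>) = \<kappa> * Re (p' a)"
    by simp
  have Re_ric: "Re (ricci g ?z $ i\<^sub>0 $ i\<^sub>0) = - (real (CARD('n) + 1) * \<kappa>) - log_psi_laplacian x"
    using ricci_eq[OF z, of i\<^sub>0 i\<^sub>0] a by (simp add: H_z flip: x_def)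
  show ?thesis
    using soliton_diagonal[OF z, of i\<^sub>0]
    by (simp only: Re_ric Re_sum D_g g_z Re_complex_of_real u'_def v'_def v_def)
qed

text \<open>
  In the mean of \<open>soliton_equation_base\<close> over a circle both terms with \<open>X\<close> are multiples of
  \<open>Re (p' 0) = 0\<close>, and \<open>\<Lambda> = - (n+1)\<close> cancels the first term of the Ricci tensor.
\<close>

lemma log_psi_laplacian_zero:
  assumes x: "x \<in> S" shows "log_psi_laplacian x = 0"
proof -
  let ?c = "circlepath 0 (sqrt x)"
  let ?\<kappa> = "\<psi> x / (F x)\<^sup>2"
  define K where "K = (((F1 x)\<^sup>2 + 2 * x * F1 x * F2 x - (F x * (2 * F2 x + x * F3 x) + F1 x * (F1 x + x * F2 x))) * (F x)\<^sup>2
         - \<psi> x * (2 * F1 x * F x)) / ((F x)\<^sup>2 * (F x)\<^sup>2)"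
  have r: "0 < sqrt x" "ereal ((sqrt x)\<^sup>2) < x\<^sub>0" using x by auto
  have "- (real (CARD('n) + 1) * ?\<kappa>) - log_psi_laplacian x - \<Lambda> * ?\<kappa>
      = K * (2 * Re (cnj (?c t) * p (?c t))) + 2 * (?\<kappa> * Re (p' (?c t)))" for t
  proof -
    have "?c t \<noteq> 0" using r by (simp add: circlepath)
    from soliton_equation_base[OF this] show ?thesis using x by (simp add: K_def)
  qed
  moreover have "((\<lambda>t. K * (2 * Re (cnj (?c t) * p (?c t))) + 2 * (?\<kappa> * Re (p' (?c t))))
      has_integral K * (2 * ((sqrt x)\<^sup>2 * Re (p' 0))) + 2 * (?\<kappa> * Re (p' 0))) {0..1}"
    by (intro has_integral_add has_integral_mult_right mean_p r)
  ultimately have "((\<lambda>_. - (real (CARD('n) + 1) * ?\<kappa>) - log_psi_laplacian x - \<Lambda> * ?\<kappa>) has_integral 0) {0..1::real}"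
    by (simp add: radial_divergence_zero)
  from has_integral_unique[OF this has_integral_const_real[of _ 0 1]]
  have "- (real (CARD('n) + 1) * ?\<kappa>) - log_psi_laplacian x - \<Lambda> * ?\<kappa> = 0" by simp
  moreover have "\<Lambda> = - real (CARD('n) + 1)"
    using soliton_constant_and_slice_relation(1)[of "of_real (sqrt x)"] x by simp
  ultimately show ?thesis by (simp only: mult_minus_left)
qed

section \<open>The differential equation for the Hartogs function\<close>

lemma convex_S: "convex S"
proof -
  have "is_interval S"
    unfolding is_interval_1 by auto (metis ereal_less_eq(3) order.strict_trans1)
  then show ?thesis by (rule is_interval_convex)
qed

lemma constant_on_S:
  assumes "\<And>x. x \<in> S \<Longrightarrow> (f has_real_derivative 0) (at x)"
  shows "\<exists>c. \<forall>x\<in>S. f x = c"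
  using has_field_derivative_zero_constant[OF convex_S, of f] has_field_derivative_at_within[OF assms]
  by blast

lemma eventually_square_in_S: "\<forall>\<^sub>F t in at_right 0. t > 0 \<and> t\<^sup>2 \<in> S"
proof -
  obtain r where r: "r \<in> S" using S_nonempty by blast
  then have "\<forall>\<^sub>F t in at_right 0. t \<in> {0<..<sqrt r}"
    by (intro eventually_at_right_real) simp
  then show ?thesis
  proof eventually_elim
    case (elim t)
    then have "t\<^sup>2 < (sqrt r)\<^sup>2" by (intro power_strict_mono) auto
    then have "t\<^sup>2 < r" using r by simp
    then show ?case using elim r order.strict_trans[of "ereal (t\<^sup>2)" "ereal r" x\<^sub>0] by simp
  qed
qed

lemma of_real_tendsto_0: "((\<lambda>t. complex_of_real t) \<longlongrightarrow> 0) (at_right 0)"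
  using tendsto_of_real[OF tendsto_ident_at, of 0 "{0<..}"] by simp

lemma smooth_base: "smooth_on {a. ereal ((cmod a)\<^sup>2) < x\<^sub>0} (\<lambda>a. F ((cmod a)\<^sup>2))"
  using spc by (simp add: strongly_pseudoconvex_hartogs_def)

lemma zero_in_base: "0 \<in> {a::complex. ereal ((cmod a)\<^sup>2) < x\<^sub>0}"
  using x0_pos by (simp add: zero_ereal_def)

lemma F_limit: "((\<lambda>t. F (t\<^sup>2)) \<longlongrightarrow> F 0) (at_right 0)"
proof -
  have "Ck_on 1 {a. ereal ((cmod a)\<^sup>2) < x\<^sub>0} (\<lambda>a. F ((cmod a)\<^sup>2))"
    using smooth_base by (simp only: smooth_on_def)
  then have "(\<lambda>a::complex. F ((cmod a)\<^sup>2)) differentiable (at 0)"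
    using zero_in_base by simp
  then have "isCont (\<lambda>a::complex. F ((cmod a)\<^sup>2)) 0"
    by (rule differentiable_imp_continuous_within)
  from isCont_tendsto_compose[OF this of_real_tendsto_0] show ?thesis by simp
qed

text \<open>
  Along the positive real axis the derivative of \<open>F(|z\<^sub>0|\<^sup>2)\<close> is \<open>2 t F'(t\<^sup>2)\<close>, which has a limit
  at \<open>0\<close> as \<open>F(|z\<^sub>0|\<^sup>2)\<close> is continuously differentiable there; hence \<open>t\<^sup>2 F'(t\<^sup>2)\<close> tends to \<open>0\<close>.
\<close>

lemma W_limit: "((\<lambda>t. W (t\<^sup>2)) \<longlongrightarrow> 0) (at_right 0)"
proof -
  let ?\<Phi> = "\<lambda>a::complex. F ((cmod a)\<^sup>2)"
  define d where "d a = frechet_derivative ?\<Phi> (at a) 1" for a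
  have "Ck_on 1 {a. ereal ((cmod a)\<^sup>2) < x\<^sub>0} ?\<Phi>"
    using smooth_base by (simp only: smooth_on_def)
  then have "continuous_on {a. ereal ((cmod a)\<^sup>2) < x\<^sub>0} d"
    by (simp add: d_def[abs_def])
  then have "isCont d 0"
    using open_base zero_in_base by (simp add: continuous_on_eq_continuous_at)
  from isCont_tendsto_compose[OF this of_real_tendsto_0]
  have d: "((\<lambda>t. d (of_real t)) \<longlongrightarrow> d 0) (at_right 0)" .
  have d_eq: "d (of_real t) = 2 * t * F1 (t\<^sup>2)" if "t > 0" "t\<^sup>2 \<in> S" for t
  proof -
    have F': "(F has_derivative (*) (F1 (t\<^sup>2))) (at (complex_of_real t \<bullet> complex_of_real t))"
      using F[of "t\<^sup>2"] that by (simp add: has_field_derivative_def inner_complex_def power2_eq_square)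
    have "((\<lambda>a. a \<bullet> a) has_derivative (\<lambda>v. complex_of_real t \<bullet> v + v \<bullet> complex_of_real t)) (at (of_real t))"
      by (intro has_derivative_inner has_derivative_ident)
    from has_derivative_compose[OF this F']
    have "(?\<Phi> has_derivative (\<lambda>v. F1 (t\<^sup>2) * (complex_of_real t \<bullet> v + v \<bullet> complex_of_real t))) (at (of_real t))"
      by (simp add: dot_square_norm)
    from frechet_derivative_at[OF this, symmetric] show ?thesis
      by (simp add: d_def inner_complex_def)
  qed
  have "((\<lambda>t. t / 2 * d (of_real t) / F (t\<^sup>2)) \<longlongrightarrow> 0 / 2 * d 0 / F 0) (at_right 0)"
    using F_pos[of 0] x0_pos
    by (intro tendsto_divide tendsto_mult d F_limit tendsto_const tendsto_ident_at) (auto simp: zero_ereal_def)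
  moreover have "\<forall>\<^sub>F t in at_right 0. t / 2 * d (of_real t) / F (t\<^sup>2) = W (t\<^sup>2)"
    using eventually_square_in_S by eventually_elim (simp add: d_eq W_def power2_eq_square)
  ultimately show ?thesis by (simp add: tendsto_cong)
qed

text \<open>
  The metric is continuous and positive definite at the origin too, and
  \<open>\<psi>/F\<^sup>2 = g\<^sub>0\<^sub>0\<close> on \<open>z' = 0\<close>.
\<close>

lemma psi_limit: "\<exists>l>0. ((\<lambda>t. \<psi> (t\<^sup>2)) \<longlongrightarrow> l) (at_right 0)"
proof -
  define G where "G z = tensor (g z) (axis i\<^sub>0 1) (axis i\<^sub>0 1)" for z
  have in_D: "slice 0 0 \<in> D"
    using F_pos[of 0] x0_pos by (simp add: slice_in_D_iff zero_ereal_def)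
  have F0: "F 0 > 0" using F_pos[of 0] x0_pos by (simp add: zero_ereal_def)
  have "Ck_on 0 D g" using kaehler unfolding kaehler_metric_on_def smooth_on_def by blast
  then have "continuous_on D (\<lambda>z. Re (g z $ i\<^sub>0 $ i\<^sub>0))"
    by (auto intro!: continuous_intros)
  then have "isCont G (slice 0 0)"
    using open_D in_D by (simp add: continuous_on_eq_continuous_at G_def[abs_def] tensor_axis_axis)
  moreover have "((\<lambda>t. slice (complex_of_real t) 0) \<longlongrightarrow> slice 0 0) (at_right 0)"
    unfolding slice_def
    by (intro tendsto_add tendsto_const bounded_linear.tendsto[OF bounded_linear_axis] of_real_tendsto_0)
  ultimately have "((\<lambda>t. G (slice (of_real t) 0)) \<longlongrightarrow> G (slice 0 0)) (at_right 0)"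
    by (rule isCont_tendsto_compose)
  then have "((\<lambda>t. G (slice (of_real t) 0) * (F (t\<^sup>2))\<^sup>2) \<longlongrightarrow> G (slice 0 0) * (F 0)\<^sup>2) (at_right 0)"
    by (intro tendsto_mult tendsto_power F_limit)
  moreover have "\<forall>\<^sub>F t in at_right 0. G (slice (of_real t) 0) * (F (t\<^sup>2))\<^sup>2 = \<psi> (t\<^sup>2)"
    using eventually_square_in_S
  proof eventually_elim
    case (elim t)
    let ?z = "slice (of_real t) 0"
    have Ft: "F (t\<^sup>2) > 0" using F_pos elim by simp
    then have z: "?z \<in> D" using elim by (simp add: slice_in_D_iff)
    have "H ?z i\<^sub>0 i\<^sub>0 = of_real (\<psi> (t\<^sup>2) / (F (t\<^sup>2))\<^sup>2)"
      using elim by (simp add: hess_log_gap_def gap_dbar_def hartogs_psi_def complex_eq_iff power2_eq_square)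
    then have "G ?z = \<psi> (t\<^sup>2) / (F (t\<^sup>2))\<^sup>2"
      using metric_eq[OF z] elim by (simp add: G_def tensor_axis_axis)
    then show ?case using Ft by simp
  qed
  ultimately have "((\<lambda>t. \<psi> (t\<^sup>2)) \<longlongrightarrow> G (slice 0 0) * (F 0)\<^sup>2) (at_right 0)"
    by (simp add: tendsto_cong)
  moreover have "G (slice 0 0) > 0"
    using kaehler in_D unfolding kaehler_metric_on_def G_def by (simp add: axis_eq_0_iff)
  ultimately show ?thesis using F0 by (intro exI[of _ "G (slice 0 0) * (F 0)\<^sup>2"]) simp
qed

text \<open>
  The equation \<open>(x (log \<psi>)')' = 0\<close> gives \<open>log \<psi> = k log x + C\<close>. A nonzero \<open>k\<close> contradicts the
  finite limit of \<open>log \<psi>\<close> at \<open>0\<close>.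
\<close>

lemma psi_constant: "\<exists>c>0. \<forall>x\<in>S. \<psi> x = c"
proof -
  have "((\<lambda>x. x * (\<psi>' x / \<psi> x)) has_real_derivative 0) (at x)" if x: "x \<in> S" for x
    using DERIV_mult[OF DERIV_ident log_psi'_has_derivative[OF x]] log_psi_laplacian_zero[OF x]
    by (simp add: log_psi_laplacian_def mult.commute)
  then obtain k where k: "\<And>x. x \<in> S \<Longrightarrow> x * (\<psi>' x / \<psi> x) = k"
    using constant_on_S[of "\<lambda>x. x * (\<psi>' x / \<psi> x)"] by blast
  have "((\<lambda>x. ln (\<psi> x) - k * ln x) has_real_derivative 0) (at x)" if x: "x \<in> S" for x
  proof -
    have "((\<lambda>x. ln (\<psi> x) - k * ln x) has_real_derivative (\<psi>' x / \<psi> x - k * (1 / x))) (at x)"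
      using x by (intro DERIV_diff DERIV_cmult log_psi_has_derivative DERIV_ln_divide) auto
    moreover have "\<psi>' x / \<psi> x - k * (1 / x) = 0"
      using k[OF x] x by (auto simp: field_simps)
    ultimately show ?thesis by simp
  qed
  then obtain C where C: "\<And>x. x \<in> S \<Longrightarrow> ln (\<psi> x) - k * ln x = C"
    using constant_on_S[of "\<lambda>x. ln (\<psi> x) - k * ln x"] by blast
  have "k = 0"
  proof (rule ccontr)
    assume "k \<noteq> 0"
    obtain l where l: "l > 0" "((\<lambda>t. \<psi> (t\<^sup>2)) \<longlongrightarrow> l) (at_right 0)" using psi_limit by blast
    \<comment> \<open>Solving \<open>log \<psi>(t\<^sup>2) = 2 k log t + C\<close> for \<open>t\<close> gives \<open>t\<close> a positive limit as \<open>t\<close> tends to \<open>0\<close>.\<close>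
    have "((\<lambda>t. exp ((ln (\<psi> (t\<^sup>2)) - C) / (2 * k))) \<longlongrightarrow> exp ((ln l - C) / (2 * k))) (at_right 0)"
      using l(1) \<open>k \<noteq> 0\<close>
      by (intro tendsto_exp tendsto_divide tendsto_diff tendsto_ln l(2) tendsto_const) auto
    moreover have "\<forall>\<^sub>F t in at_right 0. exp ((ln (\<psi> (t\<^sup>2)) - C) / (2 * k)) = t"
      using eventually_square_in_S
    proof eventually_elim
      case (elim t)
      have "ln (\<psi> (t\<^sup>2)) - C = (2 * k) * ln t"
        using C[of "t\<^sup>2"] elim by (simp add: ln_realpow)
      then show ?case using elim \<open>k \<noteq> 0\<close> by simp
    qed
    ultimately have "((\<lambda>t. t) \<longlongrightarrow> exp ((ln l - C) / (2 * k))) (at_right 0)"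
      by (simp add: tendsto_cong)
    from tendsto_unique[OF _ this tendsto_ident_at] have "exp ((ln l - C) / (2 * k)) = 0" by simp
    then show False by simp
  qed
  then have "\<psi> x = exp C" if "x \<in> S" for x
    using C[OF that] exp_ln[OF psi_pos[OF that]] by simp
  then show ?thesis by (intro exI[of _ "exp C"]) simp
qed

text \<open>
  For constant \<open>\<psi> = c\<close> the quantity \<open>W\<^sup>2 - W - c x/F\<^sup>2\<close> is a first integral, because
  \<open>W' = - c/F\<^sup>2\<close>. Its limit at \<open>0\<close> is \<open>0\<close>, which means \<open>x F'\<^sup>2 - F F' = c\<close>. Comparison with
  \<open>x F'\<^sup>2 - F F' - x F F'' = \<psi> = c\<close> leaves \<open>F'' = 0\<close>.
\<close>

lemma hartogs_function_affine:
  "\<exists>a b. a > 0 \<and> b > 0 \<and> (\<forall>x. 0 \<le> x \<and> ereal x < x\<^sub>0 \<longrightarrow> F x = a - b * x)"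
proof -
  obtain c where c: "c > 0" "\<And>x. x \<in> S \<Longrightarrow> \<psi> x = c" using psi_constant by blast
  have F0: "F 0 > 0" using F_pos[of 0] x0_pos by (simp add: zero_ereal_def)
  have "((\<lambda>x. (W x)\<^sup>2 - W x - c * x / (F x)\<^sup>2) has_real_derivative 0) (at x)" if x: "x \<in> S" for x
  proof -
    have Fx: "F x \<noteq> 0" using F_pos[of x] x by auto
    have W': "(W has_real_derivative - c / (F x)\<^sup>2) (at x)"
      using W_has_derivative[OF x] c(2)[OF x] by simp
    have F': "(F has_real_derivative F1 x) (at x)" using F x by simp
    have "((\<lambda>x. (W x)\<^sup>2 - W x - c * x / (F x)\<^sup>2) has_real_derivative
        (2 * W x * (- c / (F x)\<^sup>2) - - c / (F x)\<^sup>2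
          - (c * (F x)\<^sup>2 - c * x * (2 * F x * F1 x)) / ((F x)\<^sup>2 * (F x)\<^sup>2))) (at x)"
      using Fx by (auto intro!: derivative_eq_intros W' F' simp: power2_eq_square mult_ac)
    moreover have "2 * W x * (- c / (F x)\<^sup>2) - - c / (F x)\<^sup>2
          - (c * (F x)\<^sup>2 - c * x * (2 * F x * F1 x)) / ((F x)\<^sup>2 * (F x)\<^sup>2) = 0"
      using Fx by (simp add: W_def field_simps power2_eq_square)
    ultimately show ?thesis by simp
  qed
  then obtain k where k: "\<And>x. x \<in> S \<Longrightarrow> (W x)\<^sup>2 - W x - c * x / (F x)\<^sup>2 = k"
    using constant_on_S[of "\<lambda>x. (W x)\<^sup>2 - W x - c * x / (F x)\<^sup>2"] by blast
  have "((\<lambda>t. (W (t\<^sup>2))\<^sup>2 - W (t\<^sup>2) - c * t\<^sup>2 / (F (t\<^sup>2))\<^sup>2) \<longlongrightarrow> 0\<^sup>2 - 0 - c * 0\<^sup>2 / (F 0)\<^sup>2) (at_right 0)"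
    using F0 by (intro tendsto_diff tendsto_divide tendsto_mult tendsto_power W_limit F_limit
        tendsto_const tendsto_ident_at) auto
  moreover have "\<forall>\<^sub>F t in at_right 0. (W (t\<^sup>2))\<^sup>2 - W (t\<^sup>2) - c * t\<^sup>2 / (F (t\<^sup>2))\<^sup>2 = k"
    using eventually_square_in_S by eventually_elim (rule k, blast)
  ultimately have "((\<lambda>_. k) \<longlongrightarrow> 0) (at_right (0::real))"
    by (simp add: tendsto_cong)
  then have "k = 0" by (simp add: tendsto_const_iff)
  have first: "x * (F1 x)\<^sup>2 - F x * F1 x = c" if x: "x \<in> S" for x
  proof -
    have "F x \<noteq> 0" "x \<noteq> 0" using F_pos[of x] x by auto
    then have "x * (F1 x)\<^sup>2 - F x * F1 x = ((W x)\<^sup>2 - W x - c * x / (F x)\<^sup>2) * ((F x)\<^sup>2 / x) + c"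
      by (simp add: W_def field_simps power2_eq_square)
    then show ?thesis using k[OF x] \<open>k = 0\<close> by simp
  qed
  have F2_zero: "F2 x = 0" if x: "x \<in> S" for x
    using first[OF x] c(2)[OF x] F_pos[of x] x by (auto simp: hartogs_psi_def algebra_simps)
  have "(F1 has_real_derivative 0) (at x)" if x: "x \<in> S" for x
    using F1[of x] F2_zero[OF x] x by simp
  then obtain m where m: "\<And>x. x \<in> S \<Longrightarrow> F1 x = m"
    using constant_on_S[of F1] by blast
  have "((\<lambda>x. F x - m * x) has_real_derivative 0) (at x)" if x: "x \<in> S" for x
    using DERIV_diff[OF F DERIV_cmult_Id[of m], of x] m[OF x] x by simp
  then obtain a where a: "\<And>x. x \<in> S \<Longrightarrow> F x - m * x = a"
    using constant_on_S[of "\<lambda>x. F x - m * x"] by blast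
  have "((\<lambda>t. F (t\<^sup>2) - m * t\<^sup>2) \<longlongrightarrow> F 0 - m * 0\<^sup>2) (at_right 0)"
    by (intro tendsto_diff tendsto_mult tendsto_power F_limit tendsto_const tendsto_ident_at)
  moreover have "\<forall>\<^sub>F t in at_right 0. F (t\<^sup>2) - m * t\<^sup>2 = a"
    using eventually_square_in_S by eventually_elim (rule a, blast)
  ultimately have "((\<lambda>_. a) \<longlongrightarrow> F 0) (at_right (0::real))"
    by (simp add: tendsto_cong)
  then have a0: "a = F 0" by (simp add: tendsto_const_iff)
  obtain x where x: "x \<in> S" using S_nonempty by blast
  have "x * m\<^sup>2 - (a + m * x) * m = c" using first[OF x] a[OF x] m[OF x] by (simp add: algebra_simps)
  then have "a * (- m) = c" by (simp add: algebra_simps power2_eq_square)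
  then have "- m > 0" using c(1) F0 a0 by (metis zero_less_mult_pos)
  moreover have "F x = a - (- m) * x" if "0 \<le> x" "ereal x < x\<^sub>0" for x
  proof (cases "x = 0")
    case True then show ?thesis by (simp add: a0)
  next
    case False then show ?thesis using a[of x] that by simp
  qed
  ultimately show ?thesis using F0 a0 by blast
qed

end

section \<open>Affine Hartogs functions\<close>

lemma hartogs_metric_cong:
  assumes D: "open D" "z \<in> D"
    and eq: "\<And>w. w \<in> D \<Longrightarrow> F ((cmod (w $ i\<^sub>0))\<^sup>2) = G ((cmod (w $ i\<^sub>0))\<^sup>2)"
  shows "hartogs_metric i\<^sub>0 F z = hartogs_metric i\<^sub>0 G z"
proof -
  have "d_z \<alpha> (d_zbar \<beta> (\<lambda>w. of_real (hartogs_potential i\<^sub>0 F w))) z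
      = d_z \<alpha> (d_zbar \<beta> (\<lambda>w. of_real (hartogs_potential i\<^sub>0 G w))) z" for \<alpha> \<beta>
    by (intro d_z_cong_open[OF D] d_zbar_cong_open[OF D(1)]) (auto simp: hartogs_potential_def eq)
  then show ?thesis by (simp add: hartogs_metric_def)
qed

lemma ricci_cong:
  assumes D: "open D" "z \<in> D" and eq: "\<And>w. w \<in> D \<Longrightarrow> g w = h w"
  shows "ricci g z = ricci h z"
proof -
  have "d_z \<alpha> (d_zbar \<beta> (\<lambda>w. ln (det (g w)))) z = d_z \<alpha> (d_zbar \<beta> (\<lambda>w. ln (det (h w)))) z" for \<alpha> \<beta>
    by (intro d_z_cong_open[OF D] d_zbar_cong_open[OF D(1)]) (auto simp: eq)
  then show ?thesis by (simp add: ricci_def)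
qed

lemma affine_has_derivative:
  "((\<lambda>x. a - b * x) has_real_derivative - b) (at x)" "((\<lambda>_. - b) has_real_derivative 0) (at x)"
  for a b x :: real
  by (auto intro!: derivative_eq_intros)

text \<open>
  For an affine function the formulas hold at \<open>z\<^sub>0 = 0\<close> as well, since it is differentiable on
  the whole line.
\<close>

lemma hartogs_metric_affine:
  assumes "hartogs_gap i\<^sub>0 (\<lambda>x. a - b * x) z > 0"
  shows "hartogs_metric i\<^sub>0 (\<lambda>x. a - b * x) z $ \<alpha> $ \<beta>
    = hess_log_gap i\<^sub>0 (\<lambda>x. a - b * x) (\<lambda>_. - b) (\<lambda>_. 0) z \<alpha> \<beta>"
  using hartogs_metric_eq_hess_log_gap[OF open_UNIV UNIV_I assms affine_has_derivative] by simp

lemma ricci_affine: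
  fixes z :: "complex^'n::finite"
  assumes gap: "hartogs_gap i\<^sub>0 (\<lambda>x. a - b * x) z > 0" and ab: "a > 0" "b > 0"
  shows "ricci (hartogs_metric i\<^sub>0 (\<lambda>x. a - b * x)) z
    = (- real (CARD('n) + 1)) *\<^sub>R hartogs_metric i\<^sub>0 (\<lambda>x. a - b * x) z"
proof -
  have psi: "hartogs_psi (\<lambda>x. a - b * x) (\<lambda>_. - b) (\<lambda>_. 0) = (\<lambda>_. a * b)"
    by (auto simp: hartogs_psi_def fun_eq_iff algebra_simps power2_eq_square)
  have "ricci (hartogs_metric i\<^sub>0 (\<lambda>x. a - b * x)) z $ \<alpha> $ \<beta>
      = - (of_nat (CARD('n) + 1) * hess_log_gap i\<^sub>0 (\<lambda>x. a - b * x) (\<lambda>_. - b) (\<lambda>_. 0) z \<alpha> \<beta>)" for \<alpha> \<beta>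
    using ricci_hartogs_metric[OF open_UNIV UNIV_I gap affine_has_derivative, of "\<lambda>_. 0" "\<lambda>_. 0" \<alpha> \<beta>] ab
    by (simp add: psi)
  then show ?thesis
    by (simp add: vec_eq_iff hartogs_metric_affine[OF gap]) (simp add: scaleR_conv_of_real algebra_simps)
qed

text \<open>
  For \<open>F(x) = a - b x\<close> the function \<open>\<psi>\<close> is the constant \<open>a b\<close>, so only the term
  \<open>- (n+1) g\<close> of the Ricci tensor remains.
\<close>

lemma kaehler_einstein_affine:
  fixes i\<^sub>0 :: "'n::finite"
  assumes kaehler: "kaehler_metric_on (hartogs_domain i\<^sub>0 x\<^sub>0 F) (hartogs_metric i\<^sub>0 F)"
    and ab: "a > 0" "b > 0"
    and F: "\<And>x. 0 \<le> x \<Longrightarrow> ereal x < x\<^sub>0 \<Longrightarrow> F x = a - b * x"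
  shows "kaehler_einstein_on (hartogs_domain i\<^sub>0 x\<^sub>0 F) (hartogs_metric i\<^sub>0 F)"
proof -
  let ?D = "hartogs_domain i\<^sub>0 x\<^sub>0 F" and ?G = "\<lambda>x. a - b * x"
  have D: "open ?D" using kaehler by (simp add: kaehler_metric_on_def)
  have eq: "hartogs_metric i\<^sub>0 F z = hartogs_metric i\<^sub>0 ?G z" if "z \<in> ?D" for z
    by (rule hartogs_metric_cong[OF D that]) (simp add: hartogs_domain_def F)
  have "ricci (hartogs_metric i\<^sub>0 F) z = (- real (CARD('n) + 1)) *\<^sub>R hartogs_metric i\<^sub>0 F z"
    if z: "z \<in> ?D" for z
  proof -
    have "hartogs_gap i\<^sub>0 ?G z > 0" using z by (auto simp: hartogs_gap_def hartogs_domain_def F)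
    from ricci_affine[OF this ab] show ?thesis
      by (simp only: ricci_cong[OF D z eq] eq[OF z])
  qed
  with kaehler show ?thesis unfolding kaehler_einstein_on_def by blast
qed

definition dilation :: "'n::finite \<Rightarrow> real \<Rightarrow> real \<Rightarrow> complex^'n \<Rightarrow> complex^'n" where
  "dilation i\<^sub>0 s t z = (\<chi> k. of_real (if k = i\<^sub>0 then s else t) * z $ k)"

lemma dilation_nth [simp]: "dilation i\<^sub>0 s t z $ k = of_real (if k = i\<^sub>0 then s else t) * z $ k"
  by (simp add: dilation_def)

lemma bounded_linear_dilation: "bounded_linear (dilation i\<^sub>0 s t)"
proof -
  have "linear (dilation i\<^sub>0 s t)"
    by (intro linearI) (simp_all add: vec_eq_iff distrib_left)
  then show ?thesis by (rule linear_conv_bounded_linear[THEN iffD1])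
qed

lemma holo_map_on_dilation: "holo_map_on A (dilation i\<^sub>0 s t)"
  unfolding holo_map_on_def holo_fun_on_def
proof (intro allI ballI)
  fix k z
  have "((\<lambda>z. dilation i\<^sub>0 s t z $ k) has_derivative (\<lambda>v. dilation i\<^sub>0 s t v $ k)) (at z)"
    by (intro bounded_linear.has_derivative[OF bounded_linear_vec_nth]
        bounded_linear_imp_has_derivative bounded_linear_dilation)
  then show "\<exists>f'. ((\<lambda>z. dilation i\<^sub>0 s t z $ k) has_derivative f') (at z)
      \<and> (\<forall>c v. f' (c *s v) = c * f' v)"
    by (intro exI[of _ "\<lambda>v. dilation i\<^sub>0 s t v $ k"]) (simp add: mult_ac)
qed

lemma holo_map_on_cong:
  fixes f g :: "complex^'n \<Rightarrow> complex^'m::finite"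
  assumes "open A" "holo_map_on A f" "\<And>z. z \<in> A \<Longrightarrow> f z = g z"
  shows "holo_map_on A g"
  unfolding holo_map_on_def holo_fun_on_def
proof (intro allI ballI)
  fix k z assume z: "z \<in> A"
  then obtain f' where f': "((\<lambda>z. f z $ k) has_derivative f') (at z)" "\<forall>c v. f' (c *s v) = c * f' v"
    using assms(2) unfolding holo_map_on_def holo_fun_on_def by blast
  have "((\<lambda>z. g z $ k) has_derivative f') (at z)"
    by (rule has_derivative_transform_within_open[OF f'(1) assms(1) z]) (simp add: assms(3))
  with f'(2) show "\<exists>f'. ((\<lambda>z. g z $ k) has_derivative f') (at z) \<and> (\<forall>c v. f' (c *s v) = c * f' v)"
    by blast
qed

lemma dilation_inverse:
  assumes "s \<noteq> 0" "t \<noteq> 0"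
  shows "dilation i\<^sub>0 (1 / s) (1 / t) (dilation i\<^sub>0 s t z) = z"
    and "dilation i\<^sub>0 s t (dilation i\<^sub>0 (1 / s) (1 / t) z) = z"
  using assms by (auto simp: vec_eq_iff)

lemma biholomorphism_dilation:
  assumes D: "open D" and st: "s \<noteq> 0" "t \<noteq> 0"
  shows "biholomorphism D (dilation i\<^sub>0 s t ` D) (dilation i\<^sub>0 s t)"
proof -
  let ?\<phi> = "dilation i\<^sub>0 s t" and ?\<psi> = "dilation i\<^sub>0 (1 / s) (1 / t)"
  have image: "?\<phi> ` D = ?\<psi> -` D"
  proof (intro set_eqI iffI)
    fix w assume "w \<in> ?\<phi> ` D"
    then show "w \<in> ?\<psi> -` D" by (auto simp: dilation_inverse(1)[OF st])
  next
    fix w assume "w \<in> ?\<psi> -` D"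
    then show "w \<in> ?\<phi> ` D"
      by (intro image_eqI[of w ?\<phi> "?\<psi> w"]) (simp_all only: dilation_inverse(2)[OF st] vimage_eq)
  qed
  have open_image: "open (?\<phi> ` D)"
    unfolding image
    by (intro open_vimage[OF D] linear_continuous_on bounded_linear_dilation)
  have inj: "inj_on ?\<phi> D"
    by (rule inj_on_inverseI[of _ ?\<psi>]) (rule dilation_inverse[OF st])
  have "holo_map_on (?\<phi> ` D) (inv_into D ?\<phi>)"
    by (rule holo_map_on_cong[OF open_image holo_map_on_dilation, of i\<^sub>0 "1 / s" "1 / t"])
      (auto simp: inv_into_f_f[OF inj] dilation_inverse[OF st])
  then show ?thesis
    using D open_image inj by (simp add: biholomorphism_def holo_map_on_dilation bij_betw_imageI)
qed

text \<open>
  The dilation with \<open>s\<^sup>2 = b/a\<close> in \<open>z\<^sub>0\<close> and \<open>t\<^sup>2 = 1/a\<close> in the other coordinates satisfies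
  \<open>1 - |\<phi>(z)|\<^sup>2 = N(z) / a\<close>. The two potentials then differ by the constant \<open>log a\<close>, and \<open>\<phi>\<close>
  maps the domain into the unit ball.
\<close>

lemma holo_isometric_affine:
  fixes i\<^sub>0 :: "'n::finite"
  assumes D: "open (hartogs_domain i\<^sub>0 x\<^sub>0 F)"
    and ab: "a > 0" "b > 0"
    and F: "\<And>x. 0 \<le> x \<Longrightarrow> ereal x < x\<^sub>0 \<Longrightarrow> F x = a - b * x"
  shows "\<exists>U. open U \<and> U \<subseteq> complex_hyperbolic_space i\<^sub>0 \<and>
    holo_isometric (hartogs_domain i\<^sub>0 x\<^sub>0 F) (hartogs_metric i\<^sub>0 F) U (hyperbolic_metric i\<^sub>0)"
proof -
  let ?D = "hartogs_domain i\<^sub>0 x\<^sub>0 F" and ?G = "\<lambda>x. a - b * x" and ?h = "\<lambda>x::real. 1 - 1 * x"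
  define s t where "s = sqrt (b / a)" and "t = sqrt (1 / a)"
  define \<sigma> where "\<sigma> k = (if k = i\<^sub>0 then s else t)" for k
  let ?\<phi> = "dilation i\<^sub>0 s t"
  have st: "s \<noteq> 0" "t \<noteq> 0" "s * s = b / a" "t * t = 1 / a" using ab by (simp_all add: s_def t_def)
  have gap_pos: "hartogs_gap i\<^sub>0 ?G z > 0" if "z \<in> ?D" for z
    using that by (auto simp: hartogs_gap_def hartogs_domain_def F)
  have gap: "hartogs_gap i\<^sub>0 ?h (?\<phi> z) = hartogs_gap i\<^sub>0 ?G z / a" for z
  proof -
    have "(\<Sum>k\<in>UNIV - {i\<^sub>0}. (cmod (?\<phi> z $ k))\<^sup>2) = (\<Sum>k\<in>UNIV - {i\<^sub>0}. (cmod (z $ k))\<^sup>2 / a)"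
      using ab by (intro sum.cong) (auto simp: norm_mult power_mult_distrib t_def)
    moreover have "(cmod (?\<phi> z $ i\<^sub>0))\<^sup>2 = b / a * (cmod (z $ i\<^sub>0))\<^sup>2"
      using ab by (simp add: norm_mult power_mult_distrib s_def)
    ultimately show ?thesis
      using ab by (simp add: hartogs_gap_def sum_divide_distrib diff_divide_distrib)
  qed
  have sub: "?\<phi> ` ?D \<subseteq> complex_hyperbolic_space i\<^sub>0"
  proof (rule image_subsetI)
    fix z assume "z \<in> ?D"
    then have "hartogs_gap i\<^sub>0 ?h (?\<phi> z) > 0" using gap gap_pos ab by simp
    then have less: "(\<Sum>k\<in>UNIV - {i\<^sub>0}. (cmod (?\<phi> z $ k))\<^sup>2) < 1 - (cmod (?\<phi> z $ i\<^sub>0))\<^sup>2"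
      by (simp only: hartogs_gap_def)
    have "0 \<le> (\<Sum>k\<in>UNIV - {i\<^sub>0}. (cmod (?\<phi> z $ k))\<^sup>2)" by (intro sum_nonneg) simp
    with less have "(cmod (?\<phi> z $ i\<^sub>0))\<^sup>2 < 1" by linarith
    then show "?\<phi> z \<in> complex_hyperbolic_space i\<^sub>0"
      using less by (simp add: complex_hyperbolic_space_def hartogs_domain_def one_ereal_def del: dilation_nth)
  qed
  have metric: "hyperbolic_metric i\<^sub>0 (?\<phi> z) $ \<alpha> $ \<beta> * of_real (\<sigma> \<alpha>) * of_real (\<sigma> \<beta>)
      = hartogs_metric i\<^sub>0 F z $ \<alpha> $ \<beta>" if z: "z \<in> ?D" for z \<alpha> \<beta>
  proof -
    let ?N = "complex_of_real (hartogs_gap i\<^sub>0 ?G z)"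
    have Nz: "?N \<noteq> 0" "complex_of_real a \<noteq> 0" using gap_pos[OF z] ab by simp_all
    have st': "of_real s * of_real s = complex_of_real b / of_real a"
        "of_real t * of_real t = 1 / complex_of_real a"
      using st(3,4) by (simp_all flip: of_real_mult)
    \<comment> \<open>\<open>\<sigma>\<close> is the Jacobian of the dilation; each factor of the Hessian scales by \<open>1/a\<close>.\<close>
    have db: "gap_dbar i\<^sub>0 (\<lambda>_. - 1) (?\<phi> z) k * of_real (\<sigma> k) = gap_dbar i\<^sub>0 (\<lambda>_. - b) z k / of_real a" for k
    proof -
      have "gap_dbar i\<^sub>0 (\<lambda>_. - 1) (?\<phi> z) k * of_real (\<sigma> k)
          = - ((if k = i\<^sub>0 then of_real s * of_real s else of_real t * of_real t) * z $ k)"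
        by (simp add: gap_dbar_def \<sigma>_def mult_ac)
      then show ?thesis by (simp only: st') (simp add: gap_dbar_def)
    qed
    define m where "m = (if \<alpha> = \<beta> then if \<alpha> = i\<^sub>0 then - complex_of_real b else - 1 else 0)"
    have \<delta>: "(if \<alpha> = \<beta> then -1 else 0) * (of_real (\<sigma> \<alpha>) * of_real (\<sigma> \<beta>)) = m / of_real a"
      using st' by (auto simp: \<sigma>_def m_def)
    have "hyperbolic_metric i\<^sub>0 (?\<phi> z) $ \<alpha> $ \<beta>
        = hess_log_gap i\<^sub>0 ?h (\<lambda>_. - 1) (\<lambda>_. 0) (?\<phi> z) \<alpha> \<beta>"
      using hartogs_metric_affine[of i\<^sub>0 1 1 "?\<phi> z" \<alpha> \<beta>] gap gap_pos[OF z] ab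
      by (simp add: hyperbolic_metric_def)
    also have "\<dots> = (cnj (gap_dbar i\<^sub>0 (\<lambda>_. - 1) (?\<phi> z) \<alpha>) * gap_dbar i\<^sub>0 (\<lambda>_. - 1) (?\<phi> z) \<beta>
        - ?N / of_real a * (if \<alpha> = \<beta> then -1 else 0)) / (?N / of_real a)\<^sup>2"
      by (simp only: hess_log_gap_def gap) simp
    finally have "hyperbolic_metric i\<^sub>0 (?\<phi> z) $ \<alpha> $ \<beta> * of_real (\<sigma> \<alpha>) * of_real (\<sigma> \<beta>)
        = (cnj (gap_dbar i\<^sub>0 (\<lambda>_. - 1) (?\<phi> z) \<alpha> * of_real (\<sigma> \<alpha>))
            * (gap_dbar i\<^sub>0 (\<lambda>_. - 1) (?\<phi> z) \<beta> * of_real (\<sigma> \<beta>))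
          - ?N / of_real a * ((if \<alpha> = \<beta> then -1 else 0) * (of_real (\<sigma> \<alpha>) * of_real (\<sigma> \<beta>))))
          / (?N / of_real a)\<^sup>2"
      by (simp only: complex_cnj_mult complex_cnj_complex_of_real) (simp add: algebra_simps)
    also have "\<dots> = (cnj (gap_dbar i\<^sub>0 (\<lambda>_. - b) z \<alpha>) * gap_dbar i\<^sub>0 (\<lambda>_. - b) z \<beta> - ?N * m) / ?N\<^sup>2"
      unfolding db \<delta> using Nz by (simp add: field_simps power2_eq_square)
    also have "\<dots> = hess_log_gap i\<^sub>0 ?G (\<lambda>_. - b) (\<lambda>_. 0) z \<alpha> \<beta>"
      by (simp add: hess_log_gap_def m_def)
    also have "\<dots> = hartogs_metric i\<^sub>0 ?G z $ \<alpha> $ \<beta>"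
      by (rule hartogs_metric_affine[OF gap_pos[OF z], symmetric])
    also have "hartogs_metric i\<^sub>0 ?G z = hartogs_metric i\<^sub>0 F z"
      by (rule hartogs_metric_cong[OF D z]) (simp add: hartogs_domain_def F)
    finally show ?thesis .
  qed
  have "tensor (hyperbolic_metric i\<^sub>0 (?\<phi> z)) (?\<phi> v) (?\<phi> w) = tensor (hartogs_metric i\<^sub>0 F z) v w"
    if z: "z \<in> ?D" for z v w
    unfolding tensor_def
    by (intro arg_cong[of _ _ Re] sum.cong refl)
      (simp add: metric[OF z, symmetric] mult_ac flip: \<sigma>_def)
  moreover have "frechet_derivative ?\<phi> (at z) = ?\<phi>" for z
    by (rule frechet_derivative_at[symmetric])
      (rule bounded_linear_imp_has_derivative[OF bounded_linear_dilation])
  ultimately have "holo_isometric ?D (hartogs_metric i\<^sub>0 F) (?\<phi> ` ?D) (hyperbolic_metric i\<^sub>0)"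
    unfolding holo_isometric_def using biholomorphism_dilation[OF D st(1,2)] by metis
  moreover have "open (?\<phi> ` ?D)"
    using biholomorphism_dilation[OF D st(1,2)] by (simp add: biholomorphism_def)
  ultimately show ?thesis using sub by blast
qed

theorem theorem1p2:
  fixes i\<^sub>0 :: "'n::finite" and x\<^sub>0 :: ereal and F :: "real \<Rightarrow> real"
    and X :: "complex^'n \<Rightarrow> complex^'n"
  assumes "CARD('n) \<ge> 2"
    and "strongly_pseudoconvex_hartogs i\<^sub>0 x\<^sub>0 F"
    and "real_holo_field_on (hartogs_domain i\<^sub>0 x\<^sub>0 F) X"
    and "kaehler_ricci_soliton_on (hartogs_domain i\<^sub>0 x\<^sub>0 F) (hartogs_metric i\<^sub>0 F) X"
  shows "kaehler_einstein_on (hartogs_domain i\<^sub>0 x\<^sub>0 F) (hartogs_metric i\<^sub>0 F) \<and>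
    (\<exists>U. open U \<and> U \<subseteq> complex_hyperbolic_space i\<^sub>0 \<and>
      holo_isometric (hartogs_domain i\<^sub>0 x\<^sub>0 F) (hartogs_metric i\<^sub>0 F) U (hyperbolic_metric i\<^sub>0))"
proof -
  let ?D = "hartogs_domain i\<^sub>0 x\<^sub>0 F" and ?g = "hartogs_metric i\<^sub>0 F"
  let ?S = "{x. 0 < x \<and> ereal x < x\<^sub>0}"
  have "(UNIV :: 'n set) \<noteq> {i\<^sub>0}" using assms(1) by (metis card_1_singleton_iff One_nat_def Suc_1 not_less_eq_eq order_refl)
  then obtain j where j: "j \<noteq> i\<^sub>0" by blast
  have kaehler: "kaehler_metric_on ?D ?g" and "smooth_on ?S F"
    using assms(2) by (auto simp: strongly_pseudoconvex_hartogs_def hartogs_function_def)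
  then have "Ck_on (Suc (Suc (Suc (Suc 0)))) ?S F" unfolding smooth_on_def by blast
  then obtain F1 where F1: "\<And>x. x \<in> ?S \<Longrightarrow> (F has_real_derivative F1 x) (at x)"
    "Ck_on (Suc (Suc (Suc 0))) ?S F1" by (rule Ck_on_real_derivative) blast
  from F1(2) obtain F2 where F2: "\<And>x. x \<in> ?S \<Longrightarrow> (F1 has_real_derivative F2 x) (at x)"
    "Ck_on (Suc (Suc 0)) ?S F2" by (rule Ck_on_real_derivative) blast
  from F2(2) obtain F3 where F3: "\<And>x. x \<in> ?S \<Longrightarrow> (F2 has_real_derivative F3 x) (at x)"
    "Ck_on (Suc 0) ?S F3" by (rule Ck_on_real_derivative) blast
  from F3(2) obtain F4 where F4: "\<And>x. x \<in> ?S \<Longrightarrow> (F3 has_real_derivative F4 x) (at x)"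
    by (rule Ck_on_real_derivative) blast
  obtain \<Lambda> where soliton: "\<And>Y Z z. smooth_on ?D Y \<Longrightarrow> smooth_on ?D Z \<Longrightarrow> z \<in> ?D \<Longrightarrow>
      tensor (ricci ?g z) (Y z) (Z z) = \<Lambda> * tensor (?g z) (Y z) (Z z) + lie_derivative X ?g Y Z z"
    using assms(4) unfolding kaehler_ricci_soliton_on_def by blast
  interpret hartogs_soliton i\<^sub>0 j x\<^sub>0 F F1 F2 F3 F4 X \<Lambda>
    by unfold_locales (use j assms(2,3) F1 F2 F3 F4 soliton in \<open>auto simp: real_holo_field_on_def\<close>)
  obtain a b where "a > 0" "b > 0" "\<And>x. 0 \<le> x \<Longrightarrow> ereal x < x\<^sub>0 \<Longrightarrow> F x = a - b * x"
    using hartogs_function_affine by blast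
  from kaehler_einstein_affine[OF kaehler this] holo_isometric_affine[OF open_D this]
  show ?thesis by blast
qed

end
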